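(* Let $\mathfrak{A}_\Psi$ be the $\mathrm{C}^*$-algebra associated with a given quantum causal history, where the quantum causal history consists of a directed graph $E=(E^0,E^1,r,s)$, finite-dimensional Hilbert spaces $\{\mathcal{H}(x):x\in E^0\}$ and quantum operations $\Phi(x,y):\mathcal{B}(\mathcal{H}(x))\to\mathcal{B}(\mathcal{H}(y))$ for each pair of related events $x\le y$, satisfying the Extension, Spacelike Commutativity and Composition axioms, and where $\Psi=\{\Phi_e:e\in E^1\}$ with $\Phi_e=\Phi(x,y)$ for $e=(x,y)\in E^1$. Then $\mathfrak{A}_\Psi$ is an AF-algebra.
   Context: **Completely positive maps.** For a Hilbert space $\mathcal{H}$, $\mathcal{B}(\mathcal{H})$ is the set of bounded operators on $\mathcal{H}$. A completely positive (CP) map is a linear map $\Phi:\mathcal{B}(\mathcal{H}_1)\to\mathcal{B}(\mathcal{H}_2)$ all of whose ampliations to $k\times k$ matrices, $k\ge 1$, are positive. On finite-dimensional spaces every CP map has an operator-sum representation $\Phi(\rho)=\sum_i A_i\rho A_i^*$ with $A_i\in\mathcal{B}(\mathcal{H}_1,\mathcal{H}_2)$. A *quantum operation* is a trace-preserving CP map; equivalently $\sum_i A_i^*A_i=1_{\mathcal{H}_1}$. The dual map $\Phi^\dagger:\mathcal{B}(\mathcal{H}_2)\to\mathcal{B}(\mathcal{H}_1)$ is defined by $\mathrm{trace}(\rho\,\Phi^\dagger(\sigma))=\mathrm{trace}(\Phi(\rho)\,\sigma)$. **Directed graphs.** $E=(E^0,E^1,r,s)$ is a countable directed graph with vertex set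 $E^0$, edge set $E^1$, and range and source maps $r,s:E^1\to E^0$. Write $e=(x,y)$ when $s(e)=x$ and $r(e)=y$. In a quantum causal history there is at most one edge from $x$ to $y$. **The algebra $\mathfrak{A}_\Psi$.** Given Hilbert spaces $\{\mathcal{H}(x)\}_{x\in E^0}$ and a family $\Psi=\{\Phi_e:e\in E^1\}$ of CP maps $\Phi_e:\mathcal{B}(\mathcal{H}(s(e)))\to\mathcal{B}(\mathcal{H}(r(e)))$, put $\mathcal{H}=\bigoplus_{x\in E^0}\mathcal{H}(x)$ and let $P_x$ be the projection of $\mathcal{H}$ onto $\mathcal{H}(x)$. Choose an operator-sum representation $\{A_{e,i}:i\in\mathcal{I}_e\}$ of each $\Phi_e$ and regard each $A_{e,i}:\mathcal{H}(s(e))\to\mathcal{H}(r(e))$ as an operator on $\mathcal{H}$ in the natural way (zero on the orthogonal complement of $\mathcal{H}(s(e))$). Then $\mathfrak{A}_\Psi$ is the $\mathrm{C}^*$-algebra generated by all $P_x$ ($x\in E^0$) and all $A_{e,i}$ ($e\in E^1$, $i\in\mathcal{I}_e$); it does not depend on the choice of the operators $A_{e,i}$. **Causal terminology.** Vertices of $E$ are called events. Write $x\le y$ when $x$ precedes $y$ as an event; this is represented by a directed edge $(x,y)\in E^1$. Events $x,y$ are related if $x\le y$ or $y\le x$; otherwise they are spacelike separated, written $x\sim y$. $E$ is locally finite: for any $x,y\in E^0$ there are at most finitely many $z\in E^0$ with $x\le z\le y$. A future-directed path is a path in $E$; it is future (past) inextendible if there is no event in $E$ which is in the future (past) of the entire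 path. An acausal set is a set $\xi\subseteq E^0$ such that $x\sim y$ whenever $x,y\in\xi$. An acausal set $\xi$ is a complete future of an event $x$ if it intersects any future inextendible future-directed path that starts at $x$; a complete past is defined analogously. Put $\mathcal{A}(x)=\mathcal{B}(\mathcal{H}(x))$ and, for a set $\xi\subseteq E^0$, $\mathcal{H}(\xi)=\bigotimes_{x\in\xi}\mathcal{H}(x)$ and $\mathcal{A}(\xi)=\bigotimes_{x\in\xi}\mathcal{A}(x)$. For an acausal set $\xi$ and $x\in\xi$ let $\iota_x:\mathcal{A}(x)\hookrightarrow\mathcal{A}(\xi)$ be the natural unital embedding. If $\iota_A:\mathcal{A}_1\to\mathcal{A}_2$ and $\iota_B:\mathcal{B}_1\to\mathcal{B}_2$ are $*$-monomorphisms and $\Theta:\mathcal{A}_2\to\mathcal{B}_2$ is a map, the reduction of $\Theta$ to $\mathcal{A}_1\mapsto\mathcal{B}_1$ is $\iota_B^\dagger\circ\Theta\circ\iota_A$. **Quantum causal history.** It consists of a directed graph $E$ with a finite-dimensional Hilbert space $\mathcal{H}(x)$ for each event $x\in E^0$ and a quantum operation $\Phi(x,y):\mathcal{A}(x)\to\mathcal{A}(y)$ for each pair of related events $x\le y$ such that the following axioms are satisfied: (i) (Extension) For all $y\in E^0$ and $\zeta\subseteq E^0$ a complete future of $y$, there is a homomorphism $\Phi_F(y,\zeta):\mathcal{A}(y)\to\mathcal{A}(\zeta)$ such that $\Phi_F(y,\zeta)^\dagger$ is a quantum operation and for all $z\in\zeta$, the reduction of $\Phi_F(y,\zeta)^\dagger$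 to $\mathcal{A}(z)$ is $\Phi(y,z)^\dagger$. Likewise, for all $y\in E^0$ and $\xi\subseteq E^0$ a complete past of $y$, there is a quantum operation $\Phi_P(\xi,y):\mathcal{A}(\xi)\to\mathcal{A}(y)$ such that $\Phi_P(\xi,y)^\dagger$ is a homomorphism and for all $x\in\xi$ the reduction of $\Phi_P(\xi,y)^\dagger$ to $\mathcal{A}(x)$ is $\Phi(x,y)^\dagger$. (ii) (Spacelike Commutativity) If $x\sim y\in E^0$ and $\zeta\subseteq E^0$ is a complete future of $x$ and $y$, then the images of $\Phi_F(x,\zeta)$ and $\Phi_F(y,\zeta)$ commute inside $\mathcal{A}(\zeta)$. Likewise, if $y\sim z\in E^0$ and $\xi\subseteq E^0$ is a complete past of $y$ and $z$, then the images of $\Phi_P(\xi,y)^\dagger$ and $\Phi_P(\xi,z)^\dagger$ commute inside $\mathcal{A}(\xi)$. (iii) (Composition) If $\zeta\subseteq E^0$ is a complete future of $x$ and a complete past of $y$, then $\Phi(x,y)=\Phi_P(\zeta,y)\circ\Phi_F(x,\zeta)$. *)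

theory Defs
  imports
    "HOL-Analysis.Analysis"
    "HOL-Library.Function_Algebras"
    "Graph_Theory.Digraph"
begin

subsection \<open>Complex vector spaces\<close>

class complex_vector = ab_group_add +
  fixes scaleC :: "complex \<Rightarrow> 'a \<Rightarrow> 'a" (infixr \<open>*\<^sub>C\<close> 75)
  assumes scaleC_add_right: "a *\<^sub>C (x + y) = a *\<^sub>C x + a *\<^sub>C y"
    and scaleC_add_left: "(a + b) *\<^sub>C x = a *\<^sub>C x + b *\<^sub>C x"
    and scaleC_scaleC: "a *\<^sub>C b *\<^sub>C x = (a * b) *\<^sub>C x"
    and scaleC_one: "1 *\<^sub>C x = x"

global_interpretation complex_vector: vector_space "scaleC :: complex \<Rightarrow> 'a \<Rightarrow> 'a::complex_vector"
  by unfold_locales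
    (simp_all add: scaleC_add_right scaleC_add_left scaleC_scaleC scaleC_one)

instantiation complex :: complex_vector
begin
definition scaleC_complex :: "complex \<Rightarrow> complex \<Rightarrow> complex" where
  "scaleC_complex = (*)"
instance by standard (simp_all add: scaleC_complex_def algebra_simps)
end

instantiation "fun" :: (type, complex_vector) complex_vector
begin
definition scaleC_fun :: "complex \<Rightarrow> ('a \<Rightarrow> 'b) \<Rightarrow> 'a \<Rightarrow> 'b" where
  "scaleC_fun c f = (\<lambda>x. c *\<^sub>C f x)"
instance
  by standard
    (simp_all add: scaleC_fun_def fun_eq_iff scaleC_add_right scaleC_add_left scaleC_scaleC scaleC_one)
end

definition clinear_on :: "'a::complex_vector set \<Rightarrow> ('a \<Rightarrow> 'b::complex_vector) \<Rightarrow> bool" where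
  "clinear_on V f \<longleftrightarrow>
     (\<forall>u\<in>V. \<forall>v\<in>V. f (u + v) = f u + f v) \<and> (\<forall>c. \<forall>u\<in>V. f (c *\<^sub>C u) = c *\<^sub>C f u)"


subsection \<open>Hilbert spaces\<close>

text \<open>
  A Hilbert space is a linear subspace of an ambient complex vector space with an inner product of
  its own (conjugate-linear in the first argument), so that a family of Hilbert spaces of different
  dimensions is a function with values in \<open>hspace\<close>, and direct sums and tensor products
  are again of this form. The values of \<open>hip\<close> off the carrier are irrelevant.
\<close>

record 'a hspace =
  hcar :: "'a set"
  hip :: "'a \<Rightarrow> 'a \<Rightarrow> complex"

definition hnorm :: "'a hspace \<Rightarrow> 'a \<Rightarrow> real" where
  "hnorm S v = sqrt (Re (hip S v v))"

definition hilbert_space :: "'a::complex_vector hspace \<Rightarrow> bool" where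
  "hilbert_space S \<longleftrightarrow>
     complex_vector.subspace (hcar S) \<and>
     (\<forall>u\<in>hcar S. clinear_on (hcar S) (hip S u)) \<and>
     (\<forall>u\<in>hcar S. \<forall>v\<in>hcar S. hip S v u = cnj (hip S u v)) \<and>
     (\<forall>u\<in>hcar S. hip S u u \<in> \<real>\<^sub>\<ge>\<^sub>0) \<and>
     (\<forall>u\<in>hcar S. hip S u u = 0 \<longrightarrow> u = 0) \<and>
     (\<forall>f::nat \<Rightarrow> 'a. (\<forall>n. f n \<in> hcar S) \<and>
        (\<forall>\<epsilon>>0. \<exists>N. \<forall>m\<ge>N. \<forall>n\<ge>N. hnorm S (f m - f n) < \<epsilon>) \<longrightarrow>
        (\<exists>l\<in>hcar S. (\<lambda>n. hnorm S (f n - l)) \<longlonglongrightarrow> 0))"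

definition finite_dim :: "'a::complex_vector set \<Rightarrow> bool" where
  "finite_dim V \<longleftrightarrow> (\<exists>B. finite B \<and> V \<subseteq> complex_vector.span B)"

definition is_onb :: "'a::complex_vector hspace \<Rightarrow> 'a set \<Rightarrow> bool" where
  "is_onb S B \<longleftrightarrow> finite B \<and> B \<subseteq> hcar S \<and>
     (\<forall>u\<in>B. \<forall>v\<in>B. hip S u v = (if u = v then 1 else 0)) \<and>
     complex_vector.span B = hcar S"

text \<open>An arbitrary orthonormal basis of a finite-dimensional space; what is defined with it below
  (trace, inner product of a tensor product) does not depend on the choice.\<close>
definition onb :: "'a::complex_vector hspace \<Rightarrow> 'a set" where
  "onb S = (SOME B. is_onb S B)"

definition direct_sum :: "'v set \<Rightarrow> ('v \<Rightarrow> 'a::complex_vector hspace) \<Rightarrow> ('v \<Rightarrow> 'a) hspace" where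
  "direct_sum X H =
     \<lparr>hcar = {v. (\<forall>x\<in>X. v x \<in> hcar (H x)) \<and> (\<forall>x. x \<notin> X \<longrightarrow> v x = 0) \<and>
                (\<lambda>x. (hnorm (H x) (v x))\<^sup>2) summable_on X},
      hip = (\<lambda>u v. \<Sum>\<^sub>\<infinity>x\<in>X. hip (H x) (u x) (v x))\<rparr>"

text \<open>
  The tensor product of finitely many finite-dimensional spaces, realised as the space of
  forms on the product of the carriers that are conjugate-linear in each argument. The elementary
  tensor of a family \<open>v\<close> is the form \<open>\<lambda>w. \<Prod>x\<in>X. hip (H x) (w x) (v x)\<close>, and on
  elementary tensors the inner product is the product of the inner products.
\<close>
definition tensor :: "'v set \<Rightarrow> ('v \<Rightarrow> 'a::complex_vector hspace) \<Rightarrow> (('v \<Rightarrow> 'a) \<Rightarrow> complex) hspace" where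
  "tensor X H =
     \<lparr>hcar = {f.
        (\<forall>w. w \<notin> (\<Pi>\<^sub>E x\<in>X. hcar (H x)) \<longrightarrow> f w = 0) \<and>
        (\<forall>w\<in>\<Pi>\<^sub>E x\<in>X. hcar (H x). \<forall>x\<in>X.
           (\<forall>u\<in>hcar (H x). \<forall>u'\<in>hcar (H x). f (w(x := u + u')) = f (w(x := u)) + f (w(x := u'))) \<and>
           (\<forall>c. \<forall>u\<in>hcar (H x). f (w(x := c *\<^sub>C u)) = cnj c * f (w(x := u))))},
      hip = (\<lambda>f g. \<Sum>b\<in>(\<Pi>\<^sub>E x\<in>X. onb (H x)). cnj (f b) * g b)\<rparr>"


subsection \<open>Bounded operators\<close>

text \<open>Operators are functions that vanish off the carrier of their domain; in this way they are
  determined by their values on the carrier, and sums, multiples and compositions of operators are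
  those of functions.\<close>
definition bops :: "'a::complex_vector hspace \<Rightarrow> 'b::complex_vector hspace \<Rightarrow> ('a \<Rightarrow> 'b) set" where
  "bops S T = {f. (\<forall>v\<in>hcar S. f v \<in> hcar T) \<and> clinear_on (hcar S) f \<and>
                  (\<forall>v. v \<notin> hcar S \<longrightarrow> f v = 0) \<and>
                  (\<exists>C. \<forall>v\<in>hcar S. hnorm T (f v) \<le> C * hnorm S v)}"

abbreviation bop :: "'a::complex_vector hspace \<Rightarrow> ('a \<Rightarrow> 'a) set" where
  "bop S \<equiv> bops S S"

definition opnorm :: "'a::complex_vector hspace \<Rightarrow> ('a \<Rightarrow> 'a) \<Rightarrow> real" where
  "opnorm S f = Sup {hnorm S (f v) | v. v \<in> hcar S \<and> hnorm S v \<le> 1}"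

definition adj :: "'a::complex_vector hspace \<Rightarrow> 'b::complex_vector hspace \<Rightarrow> ('a \<Rightarrow> 'b) \<Rightarrow> 'b \<Rightarrow> 'a" where
  "adj S T f = (THE g. g \<in> bops T S \<and>
                  (\<forall>u\<in>hcar S. \<forall>v\<in>hcar T. hip S u (g v) = hip T (f u) v))"

definition positive_op :: "'a::complex_vector hspace \<Rightarrow> ('a \<Rightarrow> 'a) \<Rightarrow> bool" where
  "positive_op S f \<longleftrightarrow> f \<in> bop S \<and> (\<forall>v\<in>hcar S. hip S v (f v) \<in> \<real>\<^sub>\<ge>\<^sub>0)"

definition trace_op :: "'a::complex_vector hspace \<Rightarrow> ('a \<Rightarrow> 'a) \<Rightarrow> complex" where
  "trace_op S f = (\<Sum>e\<in>onb S. hip S e (f e))"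


subsection \<open>Maps between operator algebras\<close>

definition amp :: "nat \<Rightarrow> 'a::complex_vector hspace \<Rightarrow> (nat \<Rightarrow> 'a) hspace" where
  "amp k S = direct_sum {..<k} (\<lambda>_. S)"

definition block_op :: "nat \<Rightarrow> 'a::complex_vector hspace \<Rightarrow> (nat \<Rightarrow> nat \<Rightarrow> 'a \<Rightarrow> 'a) \<Rightarrow> (nat \<Rightarrow> 'a) \<Rightarrow> nat \<Rightarrow> 'a" where
  "block_op k S M = (\<lambda>v. if v \<in> hcar (amp k S)
     then (\<lambda>i. if i < k then \<Sum>j<k. M i j (v j) else 0) else 0)"

definition cp_map :: "'a::complex_vector hspace \<Rightarrow> 'b::complex_vector hspace \<Rightarrow> (('a \<Rightarrow> 'a) \<Rightarrow> 'b \<Rightarrow> 'b) \<Rightarrow> bool" where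
  "cp_map S T \<Phi> \<longleftrightarrow>
     (\<forall>\<rho>\<in>bop S. \<Phi> \<rho> \<in> bop T) \<and> clinear_on (bop S) \<Phi> \<and>
     (\<forall>k\<ge>1. \<forall>M. (\<forall>i<k. \<forall>j<k. M i j \<in> bop S) \<and> positive_op (amp k S) (block_op k S M)
        \<longrightarrow> positive_op (amp k T) (block_op k T (\<lambda>i j. \<Phi> (M i j))))"

definition quantum_operation :: "'a::complex_vector hspace \<Rightarrow> 'b::complex_vector hspace \<Rightarrow> (('a \<Rightarrow> 'a) \<Rightarrow> 'b \<Rightarrow> 'b) \<Rightarrow> bool" where
  "quantum_operation S T \<Phi> \<longleftrightarrow>
     cp_map S T \<Phi> \<and> (\<forall>\<rho>\<in>bop S. trace_op T (\<Phi> \<rho>) = trace_op S \<rho>)"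

definition operator_sum :: "'a::complex_vector hspace \<Rightarrow> 'b::complex_vector hspace \<Rightarrow> (('a \<Rightarrow> 'a) \<Rightarrow> 'b \<Rightarrow> 'b)
    \<Rightarrow> 'i set \<Rightarrow> ('i \<Rightarrow> 'a \<Rightarrow> 'b) \<Rightarrow> bool" where
  "operator_sum S T \<Phi> I A \<longleftrightarrow>
     finite I \<and> (\<forall>i\<in>I. A i \<in> bops S T) \<and>
     (\<forall>\<rho>\<in>bop S. \<Phi> \<rho> = (\<Sum>i\<in>I. A i \<circ> \<rho> \<circ> adj S T (A i)))"

text \<open>The dual map, for finite-dimensional spaces.\<close>
definition dual :: "'a::complex_vector hspace \<Rightarrow> 'b::complex_vector hspace \<Rightarrow> (('a \<Rightarrow> 'a) \<Rightarrow> 'b \<Rightarrow> 'b)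
    \<Rightarrow> ('b \<Rightarrow> 'b) \<Rightarrow> 'a \<Rightarrow> 'a" where
  "dual S T \<Phi> \<sigma> = (THE \<tau>. \<tau> \<in> bop S \<and>
     (\<forall>\<rho>\<in>bop S. trace_op S (\<rho> \<circ> \<tau>) = trace_op T (\<Phi> \<rho> \<circ> \<sigma>)))"

definition star_hom :: "'a::complex_vector hspace \<Rightarrow> 'b::complex_vector hspace \<Rightarrow> (('a \<Rightarrow> 'a) \<Rightarrow> 'b \<Rightarrow> 'b) \<Rightarrow> bool" where
  "star_hom S T \<phi> \<longleftrightarrow>
     (\<forall>a\<in>bop S. \<phi> a \<in> bop T) \<and> clinear_on (bop S) \<phi> \<and>
     (\<forall>a\<in>bop S. \<forall>b\<in>bop S. \<phi> (a \<circ> b) = \<phi> a \<circ> \<phi> b) \<and>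
     (\<forall>a\<in>bop S. \<phi> (adj S S a) = adj T T (\<phi> a))"

text \<open>The reduction of \<open>\<Theta> : B(S2) \<rightarrow> B(T2)\<close> along \<open>\<iota>A : B(S1) \<rightarrow> B(S2)\<close>
  and \<open>\<iota>B : B(T1) \<rightarrow> B(T2)\<close>; only the spaces on the side of \<open>\<iota>B\<close> enter.\<close>
definition reduction :: "'c::complex_vector hspace \<Rightarrow> 'd::complex_vector hspace
    \<Rightarrow> (('a \<Rightarrow> 'a) \<Rightarrow> 'b \<Rightarrow> 'b) \<Rightarrow> (('c \<Rightarrow> 'c) \<Rightarrow> 'd \<Rightarrow> 'd)
    \<Rightarrow> (('b \<Rightarrow> 'b) \<Rightarrow> 'd \<Rightarrow> 'd) \<Rightarrow> ('a \<Rightarrow> 'a) \<Rightarrow> 'c \<Rightarrow> 'c" where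
  "reduction T1 T2 \<iota>A \<iota>B \<Theta> = dual T1 T2 \<iota>B \<circ> \<Theta> \<circ> \<iota>A"

text \<open>The embedding of \<open>B(H x)\<close> into the operators on the tensor product: on forms, \<open>a\<close>
  acts by applying its adjoint to the argument at \<open>x\<close>, since
  \<open>hip (H x) u (a v) = hip (H x) (adj (H x) (H x) a u) v\<close>.\<close>
definition tensor_embed :: "'v set \<Rightarrow> ('v \<Rightarrow> 'a::complex_vector hspace) \<Rightarrow> 'v \<Rightarrow> ('a \<Rightarrow> 'a)
    \<Rightarrow> (('v \<Rightarrow> 'a) \<Rightarrow> complex) \<Rightarrow> ('v \<Rightarrow> 'a) \<Rightarrow> complex" where
  "tensor_embed X H x a = (\<lambda>f. if f \<in> hcar (tensor X H)
     then (\<lambda>w. if w \<in> (\<Pi>\<^sub>E z\<in>X. hcar (H z)) then f (w(x := adj (H x) (H x) a (w x))) else 0)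
     else 0)"


subsection \<open>C*-algebras of operators\<close>

definition op_closure :: "'a::complex_vector hspace \<Rightarrow> ('a \<Rightarrow> 'a) set \<Rightarrow> ('a \<Rightarrow> 'a) set" where
  "op_closure S \<A> = {f \<in> bop S. \<forall>\<epsilon>>0. \<exists>g\<in>\<A>. opnorm S (f - g) < \<epsilon>}"

definition cstar_subalgebra :: "'a::complex_vector hspace \<Rightarrow> ('a \<Rightarrow> 'a) set \<Rightarrow> bool" where
  "cstar_subalgebra S \<A> \<longleftrightarrow>
     \<A> \<subseteq> bop S \<and> complex_vector.subspace \<A> \<and>
     (\<forall>f\<in>\<A>. \<forall>g\<in>\<A>. f \<circ> g \<in> \<A>) \<and> (\<forall>f\<in>\<A>. adj S S f \<in> \<A>) \<and>
     op_closure S \<A> \<subseteq> \<A>"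

definition cstar_generated :: "'a::complex_vector hspace \<Rightarrow> ('a \<Rightarrow> 'a) set \<Rightarrow> ('a \<Rightarrow> 'a) set" where
  "cstar_generated S X = \<Inter>{\<A>. cstar_subalgebra S \<A> \<and> X \<subseteq> \<A>}"

definition AF_algebra :: "'a::complex_vector hspace \<Rightarrow> ('a \<Rightarrow> 'a) set \<Rightarrow> bool" where
  "AF_algebra S \<A> \<longleftrightarrow> cstar_subalgebra S \<A> \<and>
     (\<exists>F::nat \<Rightarrow> ('a \<Rightarrow> 'a) set.
        (\<forall>n. cstar_subalgebra S (F n) \<and> finite_dim (F n) \<and> F n \<subseteq> F (Suc n)) \<and>
        \<A> = op_closure S (\<Union>n. F n))"


subsection \<open>The algebra of a directed graph of completely positive maps\<close>

definition proj_op :: "'v set \<Rightarrow> ('v \<Rightarrow> 'a::complex_vector hspace) \<Rightarrow> 'v \<Rightarrow> ('v \<Rightarrow> 'a) \<Rightarrow> 'v \<Rightarrow> 'a" where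
  "proj_op X H x = (\<lambda>v. if v \<in> hcar (direct_sum X H)
     then (\<lambda>z. if z = x then v x else 0) else 0)"

definition edge_op :: "'v set \<Rightarrow> ('v \<Rightarrow> 'a::complex_vector hspace) \<Rightarrow> 'v \<Rightarrow> 'v \<Rightarrow> ('a \<Rightarrow> 'a)
    \<Rightarrow> ('v \<Rightarrow> 'a) \<Rightarrow> 'v \<Rightarrow> 'a" where
  "edge_op X H x y a = (\<lambda>v. if v \<in> hcar (direct_sum X H)
     then (\<lambda>z. if z = y then a (v x) else 0) else 0)"

text \<open>The algebra \<open>\<AA>\<^sub>\<Psi>\<close>, formed with operator-sum representations \<open>(A e i)\<^sub>i\<close>, \<open>i \<in> I e\<close>, of the
  maps in \<open>\<Psi>\<close>.\<close>
definition graph_algebra :: "('v,'e) pre_digraph \<Rightarrow> ('v \<Rightarrow> 'a::complex_vector hspace)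
    \<Rightarrow> ('e \<Rightarrow> 'i set) \<Rightarrow> ('e \<Rightarrow> 'i \<Rightarrow> 'a \<Rightarrow> 'a) \<Rightarrow> (('v \<Rightarrow> 'a) \<Rightarrow> 'v \<Rightarrow> 'a) set" where
  "graph_algebra G H I A = cstar_generated (direct_sum (verts G) H)
     ({proj_op (verts G) H x | x. x \<in> verts G} \<union>
      {edge_op (verts G) H (tail G e) (head G e) (A e i) | e i. e \<in> arcs G \<and> i \<in> I e})"


subsection \<open>Causal structure\<close>

text \<open>The relation \<open>x \<le> y\<close> is \<open>x \<rightarrow>\<^bsub>G\<^esub> y\<close>. It may or may not be reflexive: an event counts as
  related to itself, so spacelike separated events are distinct, an acausal set is one whose distinct
  elements are spacelike separated, and an event of a path does not lie in the future of that
  path.\<close>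

definition spacelike :: "('v,'e) pre_digraph \<Rightarrow> 'v \<Rightarrow> 'v \<Rightarrow> bool" where
  "spacelike G x y \<longleftrightarrow> x \<in> verts G \<and> y \<in> verts G \<and> x \<noteq> y \<and> \<not> x \<rightarrow>\<^bsub>G\<^esub> y \<and> \<not> y \<rightarrow>\<^bsub>G\<^esub> x"

definition locally_finite :: "('v,'e) pre_digraph \<Rightarrow> bool" where
  "locally_finite G \<longleftrightarrow> (\<forall>x\<in>verts G. \<forall>y\<in>verts G. finite {z \<in> verts G. x \<rightarrow>\<^bsub>G\<^esub> z \<and> z \<rightarrow>\<^bsub>G\<^esub> y})"

definition acausal :: "('v,'e) pre_digraph \<Rightarrow> 'v set \<Rightarrow> bool" where
  "acausal G \<xi> \<longleftrightarrow> \<xi> \<subseteq> verts G \<and> (\<forall>x\<in>\<xi>. \<forall>y\<in>\<xi>. x \<noteq> y \<longrightarrow> spacelike G x y)"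

text \<open>A future-directed path visits \<open>p 0, p 1, \<dots>, p n\<close>; it is infinite if \<open>n = \<infinity>\<close>.\<close>
definition future_path :: "('v,'e) pre_digraph \<Rightarrow> (nat \<Rightarrow> 'v) \<Rightarrow> enat \<Rightarrow> bool" where
  "future_path G p n \<longleftrightarrow> p 0 \<in> verts G \<and> (\<forall>i. enat (Suc i) \<le> n \<longrightarrow> p i \<rightarrow>\<^bsub>G\<^esub> p (Suc i))"

definition path_events :: "(nat \<Rightarrow> 'v) \<Rightarrow> enat \<Rightarrow> 'v set" where
  "path_events p n = {p i | i. enat i \<le> n}"

definition future_inextendible :: "('v,'e) pre_digraph \<Rightarrow> (nat \<Rightarrow> 'v) \<Rightarrow> enat \<Rightarrow> bool" where
  "future_inextendible G p n \<longleftrightarrow>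
     \<not> (\<exists>z\<in>verts G. z \<notin> path_events p n \<and> (\<forall>y\<in>path_events p n. y \<rightarrow>\<^bsub>G\<^esub> z))"

definition complete_future :: "('v,'e) pre_digraph \<Rightarrow> 'v \<Rightarrow> 'v set \<Rightarrow> bool" where
  "complete_future G x \<xi> \<longleftrightarrow> acausal G \<xi> \<and>
     (\<forall>p n. future_path G p n \<and> p 0 = x \<and> future_inextendible G p n \<longrightarrow> path_events p n \<inter> \<xi> \<noteq> {})"

text \<open>Past inextendible future-directed paths that end at \<open>x\<close> are traversed backwards, from
  \<open>x\<close> on, as paths in the reversed graph.\<close>
definition reverse_digraph :: "('v,'e) pre_digraph \<Rightarrow> ('v,'e) pre_digraph" where
  "reverse_digraph G = \<lparr>verts = verts G, arcs = arcs G, tail = head G, head = tail G\<rparr>"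

definition complete_past :: "('v,'e) pre_digraph \<Rightarrow> 'v \<Rightarrow> 'v set \<Rightarrow> bool" where
  "complete_past G x \<xi> \<longleftrightarrow> complete_future (reverse_digraph G) x \<xi>"


subsection \<open>Quantum causal histories\<close>

text \<open>
  The axioms speak of duals with respect to the trace, and hence of complete futures and pasts
  \<open>\<zeta>\<close> whose tensor product is finite-dimensional; they are imposed for finite \<open>\<zeta>\<close>.
  The conditions on \<open>\<Phi> x y\<close> are imposed where \<open>\<Phi> x y\<close> is part of the structure,
  that is for \<open>x \<rightarrow>\<^bsub>G\<^esub> y\<close>: a complete future of \<open>x\<close> may have elements spacelike to \<open>x\<close>.
\<close>

definition extension_axiom :: "('v,'e) pre_digraph \<Rightarrow> ('v \<Rightarrow> 'a::complex_vector hspace)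
    \<Rightarrow> ('v \<Rightarrow> 'v \<Rightarrow> ('a \<Rightarrow> 'a) \<Rightarrow> 'a \<Rightarrow> 'a)
    \<Rightarrow> ('v \<Rightarrow> 'v set \<Rightarrow> ('a \<Rightarrow> 'a) \<Rightarrow> (('v \<Rightarrow> 'a) \<Rightarrow> complex) \<Rightarrow> ('v \<Rightarrow> 'a) \<Rightarrow> complex)
    \<Rightarrow> ('v set \<Rightarrow> 'v \<Rightarrow> ((('v \<Rightarrow> 'a) \<Rightarrow> complex) \<Rightarrow> ('v \<Rightarrow> 'a) \<Rightarrow> complex) \<Rightarrow> 'a \<Rightarrow> 'a) \<Rightarrow> bool" where
  "extension_axiom G H \<Phi> \<Phi>F \<Phi>P \<longleftrightarrow>
     (\<forall>y\<in>verts G. \<forall>\<zeta>. finite \<zeta> \<and> complete_future G y \<zeta> \<longrightarrow>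
        star_hom (H y) (tensor \<zeta> H) (\<Phi>F y \<zeta>) \<and>
        quantum_operation (tensor \<zeta> H) (H y) (dual (H y) (tensor \<zeta> H) (\<Phi>F y \<zeta>)) \<and>
        (\<forall>z\<in>\<zeta>. y \<rightarrow>\<^bsub>G\<^esub> z \<longrightarrow> (\<forall>\<sigma>\<in>bop (H z).
           reduction (H y) (H y) (tensor_embed \<zeta> H z) (\<lambda>b. b)
             (dual (H y) (tensor \<zeta> H) (\<Phi>F y \<zeta>)) \<sigma> = dual (H y) (H z) (\<Phi> y z) \<sigma>))) \<and>
     (\<forall>y\<in>verts G. \<forall>\<xi>. finite \<xi> \<and> complete_past G y \<xi> \<longrightarrow>
        quantum_operation (tensor \<xi> H) (H y) (\<Phi>P \<xi> y) \<and>
        star_hom (H y) (tensor \<xi> H) (dual (tensor \<xi> H) (H y) (\<Phi>P \<xi> y)) \<and>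
        (\<forall>x\<in>\<xi>. x \<rightarrow>\<^bsub>G\<^esub> y \<longrightarrow> (\<forall>\<sigma>\<in>bop (H y).
           reduction (H x) (tensor \<xi> H) (\<lambda>a. a) (tensor_embed \<xi> H x)
             (dual (tensor \<xi> H) (H y) (\<Phi>P \<xi> y)) \<sigma> = dual (H x) (H y) (\<Phi> x y) \<sigma>)))"

definition spacelike_commutativity_axiom :: "('v,'e) pre_digraph \<Rightarrow> ('v \<Rightarrow> 'a::complex_vector hspace)
    \<Rightarrow> ('v \<Rightarrow> 'v set \<Rightarrow> ('a \<Rightarrow> 'a) \<Rightarrow> (('v \<Rightarrow> 'a) \<Rightarrow> complex) \<Rightarrow> ('v \<Rightarrow> 'a) \<Rightarrow> complex)
    \<Rightarrow> ('v set \<Rightarrow> 'v \<Rightarrow> ((('v \<Rightarrow> 'a) \<Rightarrow> complex) \<Rightarrow> ('v \<Rightarrow> 'a) \<Rightarrow> complex) \<Rightarrow> 'a \<Rightarrow> 'a) \<Rightarrow> bool" where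
  "spacelike_commutativity_axiom G H \<Phi>F \<Phi>P \<longleftrightarrow>
     (\<forall>x y \<zeta>. spacelike G x y \<and> finite \<zeta> \<and> complete_future G x \<zeta> \<and> complete_future G y \<zeta> \<longrightarrow>
        (\<forall>a\<in>bop (H x). \<forall>b\<in>bop (H y). \<Phi>F x \<zeta> a \<circ> \<Phi>F y \<zeta> b = \<Phi>F y \<zeta> b \<circ> \<Phi>F x \<zeta> a)) \<and>
     (\<forall>y z \<xi>. spacelike G y z \<and> finite \<xi> \<and> complete_past G y \<xi> \<and> complete_past G z \<xi> \<longrightarrow>
        (\<forall>a\<in>bop (H y). \<forall>b\<in>bop (H z).
           dual (tensor \<xi> H) (H y) (\<Phi>P \<xi> y) a \<circ> dual (tensor \<xi> H) (H z) (\<Phi>P \<xi> z) b =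
           dual (tensor \<xi> H) (H z) (\<Phi>P \<xi> z) b \<circ> dual (tensor \<xi> H) (H y) (\<Phi>P \<xi> y) a))"

definition composition_axiom :: "('v,'e) pre_digraph \<Rightarrow> ('v \<Rightarrow> 'a::complex_vector hspace)
    \<Rightarrow> ('v \<Rightarrow> 'v \<Rightarrow> ('a \<Rightarrow> 'a) \<Rightarrow> 'a \<Rightarrow> 'a)
    \<Rightarrow> ('v \<Rightarrow> 'v set \<Rightarrow> ('a \<Rightarrow> 'a) \<Rightarrow> (('v \<Rightarrow> 'a) \<Rightarrow> complex) \<Rightarrow> ('v \<Rightarrow> 'a) \<Rightarrow> complex)
    \<Rightarrow> ('v set \<Rightarrow> 'v \<Rightarrow> ((('v \<Rightarrow> 'a) \<Rightarrow> complex) \<Rightarrow> ('v \<Rightarrow> 'a) \<Rightarrow> complex) \<Rightarrow> 'a \<Rightarrow> 'a) \<Rightarrow> bool" where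
  "composition_axiom G H \<Phi> \<Phi>F \<Phi>P \<longleftrightarrow>
     (\<forall>x y \<zeta>. x \<rightarrow>\<^bsub>G\<^esub> y \<and> finite \<zeta> \<and> complete_future G x \<zeta> \<and> complete_past G y \<zeta> \<longrightarrow>
        (\<forall>\<rho>\<in>bop (H x). \<Phi> x y \<rho> = \<Phi>P \<zeta> y (\<Phi>F x \<zeta> \<rho>)))"

definition quantum_causal_history :: "('v,'e) pre_digraph \<Rightarrow> ('v \<Rightarrow> 'a::complex_vector hspace)
    \<Rightarrow> ('v \<Rightarrow> 'v \<Rightarrow> ('a \<Rightarrow> 'a) \<Rightarrow> 'a \<Rightarrow> 'a) \<Rightarrow> bool" where
  "quantum_causal_history G H \<Phi> \<longleftrightarrow>
     nomulti_digraph G \<and> countable (verts G) \<and> countable (arcs G) \<and> locally_finite G \<and>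
     (\<forall>x\<in>verts G. hilbert_space (H x) \<and> finite_dim (hcar (H x))) \<and>
     (\<forall>x y. x \<rightarrow>\<^bsub>G\<^esub> y \<longrightarrow> quantum_operation (H x) (H y) (\<Phi> x y)) \<and>
     (\<exists>\<Phi>F \<Phi>P. extension_axiom G H \<Phi> \<Phi>F \<Phi>P \<and>
        spacelike_commutativity_axiom G H \<Phi>F \<Phi>P \<and> composition_axiom G H \<Phi> \<Phi>F \<Phi>P)"

end

theory Submission
  imports Defs
begin

text \<open>
  Enumerate the vertices and let \<open>P\<^sub>n\<close> be the projection onto the summands of the first \<open>n\<close> of
  them. The operators \<open>f\<close> of the algebra with \<open>P\<^sub>n f = f = f P\<^sub>n\<close> form a C*-subalgebra, which has
  finite dimension because \<open>P\<^sub>n\<close> has finite rank. These subalgebras increase with \<open>n\<close>, and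
  every generator lies in one of them: a vertex projection or an edge operator only involves one or
  two summands. So the closure of their union, being a C*-algebra, is the whole algebra.
\<close>

subsection \<open>Operators on inner product spaces\<close>

text \<open>The ambient space may be an infinite direct sum, and \<open>adj\<close> is a definite
  description, so nothing can be said about adjoints until their existence there is established;
  this takes more work than the approximation itself. The finite-dimensional summands make it
  possible: a functional is represented coordinate by coordinate, and a norm bound on finite partial
  sums glues the coordinates to one vector. The subalgebras are cut out by the two equations on
  \<open>f\<close> instead of being written as compressions. Their elements then lie in the algebra
  by definition, taking adjoints merely exchanges the two equations, and norm limits inherit them.
  Since \<open>cstar_generated\<close> is an intersection, it can be placed inside the closure of
  the union only once that closure is known to be a C*-subalgebra; the norm estimates for products
  and adjoints serve this purpose.\<close>

locale ip_space =
  fixes S :: "'a::complex_vector hspace"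
  assumes subspace: "complex_vector.subspace (hcar S)"
    and linear_right: "u \<in> hcar S \<Longrightarrow> clinear_on (hcar S) (hip S u)"
    and herm: "u \<in> hcar S \<Longrightarrow> v \<in> hcar S \<Longrightarrow> hip S v u = cnj (hip S u v)"
    and pos: "u \<in> hcar S \<Longrightarrow> hip S u u \<in> \<real>\<^sub>\<ge>\<^sub>0"
    and definite: "u \<in> hcar S \<Longrightarrow> hip S u u = 0 \<Longrightarrow> u = 0"
begin

lemma zero_mem [simp]: "0 \<in> hcar S"
  using subspace by (rule complex_vector.subspace_0)

lemma add_mem: "u \<in> hcar S \<Longrightarrow> v \<in> hcar S \<Longrightarrow> u + v \<in> hcar S"
  using subspace by (rule complex_vector.subspace_add)

lemma diff_mem: "u \<in> hcar S \<Longrightarrow> v \<in> hcar S \<Longrightarrow> u - v \<in> hcar S"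
  using subspace by (rule complex_vector.subspace_diff)

lemma scale_mem: "u \<in> hcar S \<Longrightarrow> c *\<^sub>C u \<in> hcar S"
  using subspace by (rule complex_vector.subspace_scale)

lemma sum_mem: "(\<And>i. i \<in> B \<Longrightarrow> u i \<in> hcar S) \<Longrightarrow> (\<Sum>i\<in>B. u i) \<in> hcar S"
  using subspace by (rule complex_vector.subspace_sum)

lemma ip_add_right:
  "u \<in> hcar S \<Longrightarrow> v \<in> hcar S \<Longrightarrow> w \<in> hcar S \<Longrightarrow> hip S u (v + w) = hip S u v + hip S u w"
  using linear_right by (simp add: clinear_on_def)

lemma ip_scale_right:
  "u \<in> hcar S \<Longrightarrow> v \<in> hcar S \<Longrightarrow> hip S u (c *\<^sub>C v) = c * hip S u v"
  using linear_right by (simp add: clinear_on_def scaleC_complex_def)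

lemma ip_add_left:
  "u \<in> hcar S \<Longrightarrow> v \<in> hcar S \<Longrightarrow> w \<in> hcar S \<Longrightarrow> hip S (u + v) w = hip S u w + hip S v w"
  by (metis add_mem complex_cnj_add herm ip_add_right)

lemma ip_scale_left:
  "u \<in> hcar S \<Longrightarrow> v \<in> hcar S \<Longrightarrow> hip S (c *\<^sub>C u) v = cnj c * hip S u v"
  by (metis scale_mem complex_cnj_mult herm ip_scale_right)

lemma ip_zero_right [simp]: "u \<in> hcar S \<Longrightarrow> hip S u 0 = 0"
  using ip_add_right[of u 0 0] by simp

lemma ip_zero_left [simp]: "u \<in> hcar S \<Longrightarrow> hip S 0 u = 0"
  using ip_add_left[of 0 0 u] by simp

lemma ip_diff_right:
  "u \<in> hcar S \<Longrightarrow> v \<in> hcar S \<Longrightarrow> w \<in> hcar S \<Longrightarrow> hip S u (v - w) = hip S u v - hip S u w"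
  using ip_add_right[of u "v - w" w] by (simp add: diff_mem)

lemma ip_diff_left:
  "u \<in> hcar S \<Longrightarrow> v \<in> hcar S \<Longrightarrow> w \<in> hcar S \<Longrightarrow> hip S (u - v) w = hip S u w - hip S v w"
  using ip_add_left[of "u - v" v w] by (simp add: diff_mem)

lemma ip_sum_right:
  assumes "u \<in> hcar S" "\<And>i. i \<in> B \<Longrightarrow> v i \<in> hcar S"
  shows "hip S u (\<Sum>i\<in>B. v i) = (\<Sum>i\<in>B. hip S u (v i))"
  using assms by (induction B rule: infinite_finite_induct) (simp_all add: ip_add_right sum_mem)

lemma ip_sum_left:
  assumes "u \<in> hcar S" "\<And>i. i \<in> B \<Longrightarrow> v i \<in> hcar S"
  shows "hip S (\<Sum>i\<in>B. v i) u = (\<Sum>i\<in>B. hip S (v i) u)"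
  using assms by (induction B rule: infinite_finite_induct) (simp_all add: ip_add_left sum_mem)

lemma Re_ip_nonneg: "u \<in> hcar S \<Longrightarrow> 0 \<le> Re (hip S u u)"
  using pos by (simp add: complex_nonneg_Reals_iff)

lemma hnorm_nonneg: "u \<in> hcar S \<Longrightarrow> 0 \<le> hnorm S u"
  by (simp add: hnorm_def Re_ip_nonneg)

lemma hnorm_sq: "u \<in> hcar S \<Longrightarrow> (hnorm S u)\<^sup>2 = Re (hip S u u)"
  by (simp add: hnorm_def Re_ip_nonneg)

lemma ip_self: "u \<in> hcar S \<Longrightarrow> hip S u u = of_real ((hnorm S u)\<^sup>2)"
  using pos[of u] by (simp add: hnorm_sq complex_nonneg_Reals_iff complex_eq_iff)

lemma hnorm_zero [simp]: "hnorm S 0 = 0"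
  by (simp add: hnorm_def)

lemma hnorm_eq_0D: "u \<in> hcar S \<Longrightarrow> hnorm S u = 0 \<Longrightarrow> u = 0"
  using definite by (simp add: ip_self)

lemma hnorm_scale: "u \<in> hcar S \<Longrightarrow> hnorm S (c *\<^sub>C u) = cmod c * hnorm S u"
proof -
  assume u: "u \<in> hcar S"
  have "hip S (c *\<^sub>C u) (c *\<^sub>C u) = (c * cnj c) * of_real ((hnorm S u)\<^sup>2)"
    by (simp only: ip_self[OF u, symmetric] ip_scale_left[OF u scale_mem[OF u]] ip_scale_right[OF u u])
      (simp add: mult_ac)
  also have "\<dots> = of_real ((cmod c * hnorm S u)\<^sup>2)"
    by (simp only: complex_norm_square[symmetric] power_mult_distrib of_real_mult)
  finally have "(hnorm S (c *\<^sub>C u))\<^sup>2 = (cmod c * hnorm S u)\<^sup>2"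
    using u by (simp add: ip_self scale_mem del: of_real_power of_real_mult)
  then show ?thesis
    using u by (simp add: hnorm_nonneg scale_mem)
qed

text \<open>Removing from \<open>u\<close> its component along \<open>v\<close> leaves a vector
  \<open>w\<close> orthogonal to \<open>v\<close>. Its square length is the square length of
  \<open>u\<close> minus that of the removed component, and nonnegativity of this number is the
  inequality.\<close>

lemma cauchy_schwarz:
  assumes u: "u \<in> hcar S" and v: "v \<in> hcar S"
  shows "cmod (hip S u v) \<le> hnorm S u * hnorm S v"
proof (cases "hnorm S v = 0")
  case True
  then show ?thesis using hnorm_eq_0D[OF v] u v by simp
next
  case False
  define n where "n = (hnorm S v)\<^sup>2"
  define a where "a = hip S v u"
  have n: "n > 0" using False by (simp add: n_def)
  have vv: "hip S v v = of_real n" using v by (simp add: ip_self n_def)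
  have uv: "hip S u v = cnj a" using herm[OF v u] by (simp add: a_def)
  define w where "w = u - (a / of_real n) *\<^sub>C v"
  have w: "w \<in> hcar S" using u v by (simp add: w_def diff_mem scale_mem)
  have "hip S v w = 0"
    using u v n by (simp add: w_def ip_diff_right ip_scale_right scale_mem vv a_def)
  then have "hip S (u - (a / of_real n) *\<^sub>C v) w = hip S u w"
    using u v w by (simp add: ip_diff_left ip_scale_left scale_mem)
  then have "hip S w w = hip S u w" by (simp only: w_def[symmetric])
  also have "\<dots> = of_real ((hnorm S u)\<^sup>2) - a * cnj a / of_real n"
    using u v by (simp add: w_def ip_diff_right ip_scale_right scale_mem uv ip_self)
  also have "\<dots> = of_real ((hnorm S u)\<^sup>2 - (cmod a)\<^sup>2 / n)"
    by (simp only: complex_norm_square[symmetric] of_real_diff of_real_divide)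
  finally have "0 \<le> (hnorm S u)\<^sup>2 - (cmod a)\<^sup>2 / n"
    using Re_ip_nonneg[OF w] by (simp del: of_real_diff)
  then have "(cmod a)\<^sup>2 \<le> (hnorm S u * hnorm S v)\<^sup>2"
    using n by (simp add: field_simps n_def power_mult_distrib)
  then have "cmod a \<le> hnorm S u * hnorm S v"
    by (rule power2_le_imp_le) (use u v in \<open>simp add: hnorm_nonneg\<close>)
  then show ?thesis by (simp add: uv)
qed

lemma hnorm_triangle:
  assumes u: "u \<in> hcar S" and v: "v \<in> hcar S"
  shows "hnorm S (u + v) \<le> hnorm S u + hnorm S v"
proof -
  have "(hnorm S (u + v))\<^sup>2 = (hnorm S u)\<^sup>2 + (hnorm S v)\<^sup>2 + 2 * Re (hip S u v)"
    using u v herm[OF u v] by (simp add: hnorm_sq ip_add_left ip_add_right add_mem)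
  also have "Re (hip S u v) \<le> hnorm S u * hnorm S v"
    using cauchy_schwarz[OF u v] complex_Re_le_cmod order_trans by blast
  finally have "(hnorm S (u + v))\<^sup>2 \<le> (hnorm S u + hnorm S v)\<^sup>2"
    by (simp add: power2_sum)
  then show ?thesis
    by (rule power2_le_imp_le) (use u v in \<open>simp_all add: hnorm_nonneg\<close>)
qed

text \<open>Test with \<open>u = v - w\<close> and use definiteness. All identities about adjoints
  are later proved through this principle.\<close>

lemma eq_if_ip_eq:
  assumes "v \<in> hcar S" "w \<in> hcar S" "\<And>u. u \<in> hcar S \<Longrightarrow> hip S u v = hip S u w"
  shows "v = w"
  using definite[of "v - w"] assms by (simp add: ip_diff_right diff_mem)

section \<open>Bounded operators and the operator norm\<close>

lemma bop_mem: "f \<in> bop S \<Longrightarrow> v \<in> hcar S \<Longrightarrow> f v \<in> hcar S"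
  by (simp add: bops_def)

lemma bop_off: "f \<in> bop S \<Longrightarrow> v \<notin> hcar S \<Longrightarrow> f v = 0"
  by (simp add: bops_def)

lemma bop_add:
  "f \<in> bop S \<Longrightarrow> u \<in> hcar S \<Longrightarrow> v \<in> hcar S \<Longrightarrow> f (u + v) = f u + f v"
  by (simp add: bops_def clinear_on_def)

lemma bop_scale: "f \<in> bop S \<Longrightarrow> u \<in> hcar S \<Longrightarrow> f (c *\<^sub>C u) = c *\<^sub>C f u"
  by (simp add: bops_def clinear_on_def)

lemma bop_zero: "f \<in> bop S \<Longrightarrow> f 0 = 0"
  using bop_add[of f 0 0] by simp

lemma bop_diff:
  "f \<in> bop S \<Longrightarrow> u \<in> hcar S \<Longrightarrow> v \<in> hcar S \<Longrightarrow> f (u - v) = f u - f v"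
  using bop_add[of f "u - v" v] by (simp add: diff_mem)

lemma bop_sum:
  assumes "f \<in> bop S" "\<And>i. i \<in> B \<Longrightarrow> v i \<in> hcar S"
  shows "f (\<Sum>i\<in>B. v i) = (\<Sum>i\<in>B. f (v i))"
  using assms
  by (induction B rule: infinite_finite_induct) (simp_all add: bop_add sum_mem bop_zero)

lemma bopI:
  assumes "\<And>v. v \<in> hcar S \<Longrightarrow> f v \<in> hcar S"
    and "\<And>u v. u \<in> hcar S \<Longrightarrow> v \<in> hcar S \<Longrightarrow> f (u + v) = f u + f v"
    and "\<And>c u. u \<in> hcar S \<Longrightarrow> f (c *\<^sub>C u) = c *\<^sub>C f u"
    and "\<And>v. v \<notin> hcar S \<Longrightarrow> f v = 0"
    and "\<And>v. v \<in> hcar S \<Longrightarrow> hnorm S (f v) \<le> C * hnorm S v"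
  shows "f \<in> bop S"
  unfolding bops_def clinear_on_def using assms by (auto intro: exI[of _ C])

text \<open>Operators vanish off the carrier by convention, so agreement on the carrier is equality
  of functions.\<close>

lemma bop_eqI:
  assumes "f \<in> bop S" "g \<in> bop S" "\<And>v. v \<in> hcar S \<Longrightarrow> f v = g v"
  shows "f = g"
proof
  show "f v = g v" for v using assms by (cases "v \<in> hcar S") (simp_all add: bop_off)
qed

text \<open>\<open>opnorm\<close> is a supremum of reals and says something only about sets that are
  bounded above.\<close>

lemma opnorm_bdd:
  assumes "f \<in> bop S"
  shows "bdd_above {hnorm S (f v) | v. v \<in> hcar S \<and> hnorm S v \<le> 1}"
proof -
  obtain C where C: "\<And>v. v \<in> hcar S \<Longrightarrow> hnorm S (f v) \<le> C * hnorm S v"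
    using assms by (auto simp: bops_def)
  \<comment> \<open>The constant in \<open>bops\<close> carries no sign condition; on the zero space
    it may be negative, hence the absolute value.\<close>
  have "hnorm S (f v) \<le> \<bar>C\<bar>" if "v \<in> hcar S" "hnorm S v \<le> 1" for v
  proof -
    have "C * hnorm S v \<le> \<bar>C\<bar> * 1"
      using that by (intro mult_mono) (simp_all add: hnorm_nonneg)
    then show ?thesis using C[OF that(1)] by simp
  qed
  then show ?thesis by (auto intro!: bdd_aboveI)
qed

lemma opnorm_nonneg:
  assumes "f \<in> bop S"
  shows "0 \<le> opnorm S f"
proof -
  have "hnorm S (f 0) \<le> opnorm S f"
    unfolding opnorm_def by (rule cSup_upper[OF _ opnorm_bdd[OF assms]]) auto
  then show ?thesis using assms by (simp add: bop_zero)
qed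

text \<open>Rescale \<open>v\<close> to a unit vector; a vector of norm zero is zero by definiteness
  and is handled apart.\<close>

lemma opnorm_bound:
  assumes f: "f \<in> bop S" and v: "v \<in> hcar S"
  shows "hnorm S (f v) \<le> opnorm S f * hnorm S v"
proof (cases "hnorm S v = 0")
  case True
  then show ?thesis using hnorm_eq_0D[OF v] by (simp add: bop_zero[OF f])
next
  case False
  then have n: "hnorm S v > 0" using hnorm_nonneg[OF v] by simp
  define u where "u = of_real (inverse (hnorm S v)) *\<^sub>C v"
  have u: "u \<in> hcar S" "hnorm S u = 1"
    using v n by (simp_all add: u_def scale_mem hnorm_scale norm_inverse)
  have "hnorm S (f u) \<le> opnorm S f"
    unfolding opnorm_def by (rule cSup_upper[OF _ opnorm_bdd[OF f]]) (use u in auto)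
  moreover have "hnorm S (f u) = hnorm S (f v) / hnorm S v"
    using n bop_scale[OF f v] hnorm_scale[OF bop_mem[OF f v]]
    by (simp add: u_def norm_inverse divide_inverse)
  ultimately show ?thesis using n by (simp add: field_simps)
qed

lemma opnorm_le:
  assumes "0 \<le> C" "\<And>v. v \<in> hcar S \<Longrightarrow> hnorm S (f v) \<le> C * hnorm S v"
  shows "opnorm S f \<le> C"
  unfolding opnorm_def
proof (rule cSup_least)
  show "{hnorm S (f v) |v. v \<in> hcar S \<and> hnorm S v \<le> 1} \<noteq> {}"
    by (auto intro!: exI[of _ 0])
  fix x assume "x \<in> {hnorm S (f v) |v. v \<in> hcar S \<and> hnorm S v \<le> 1}"
  then obtain v where v: "v \<in> hcar S" "hnorm S v \<le> 1" and x: "x = hnorm S (f v)" by auto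
  show "x \<le> C"
    using assms(2)[OF v(1)] mult_left_mono[OF v(2) assms(1)] by (simp add: x)
qed

text \<open>This and the next two estimates are pointwise because each is used twice: as the
  boundedness witness in \<open>bopI\<close>, and through \<open>opnorm_le\<close> as a bound on the
  operator norm.\<close>

lemma add_bound:
  assumes f: "f \<in> bop S" and g: "g \<in> bop S" and v: "v \<in> hcar S"
  shows "hnorm S ((f + g) v) \<le> (opnorm S f + opnorm S g) * hnorm S v"
  using hnorm_triangle[OF bop_mem[OF f v] bop_mem[OF g v]] opnorm_bound[OF f v] opnorm_bound[OF g v]
  by (simp add: distrib_right)

lemma comp_bound:
  assumes f: "f \<in> bop S" and g: "g \<in> bop S" and v: "v \<in> hcar S"
  shows "hnorm S ((f \<circ> g) v) \<le> (opnorm S f * opnorm S g) * hnorm S v"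
  using opnorm_bound[OF f bop_mem[OF g v]] mult_left_mono[OF opnorm_bound[OF g v] opnorm_nonneg[OF f]]
  by (simp add: mult.assoc)

lemma scale_bound:
  assumes f: "f \<in> bop S" and v: "v \<in> hcar S"
  shows "hnorm S ((c *\<^sub>C f) v) \<le> (cmod c * opnorm S f) * hnorm S v"
  using mult_left_mono[OF opnorm_bound[OF f v] norm_ge_zero[of c]] hnorm_scale[OF bop_mem[OF f v]]
  by (simp add: scaleC_fun_def mult.assoc)

lemma bop_plus: "f \<in> bop S \<Longrightarrow> g \<in> bop S \<Longrightarrow> f + g \<in> bop S"
  by (rule bopI[OF _ _ _ _ add_bound])
    (simp_all add: add_mem bop_mem bop_add bop_scale bop_off scaleC_add_right)

lemma bop_scaleC: "f \<in> bop S \<Longrightarrow> c *\<^sub>C f \<in> bop S"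
  by (rule bopI[OF _ _ _ _ scale_bound])
    (simp_all add: scaleC_fun_def scale_mem bop_mem bop_add bop_scale bop_off scaleC_add_right
      scaleC_scaleC mult.commute)

lemma bop_comp: "f \<in> bop S \<Longrightarrow> g \<in> bop S \<Longrightarrow> f \<circ> g \<in> bop S"
  by (rule bopI[OF _ _ _ _ comp_bound])
    (simp_all add: bop_mem bop_add bop_scale bop_off bop_zero)

lemma bop_0: "0 \<in> bop S"
  by (rule bopI[where C = 0]) simp_all

lemma bop_subspace: "complex_vector.subspace (bop S)"
  by (rule complex_vector.subspaceI) (simp_all add: bop_0 bop_plus bop_scaleC)

lemma bop_minus: "f \<in> bop S \<Longrightarrow> g \<in> bop S \<Longrightarrow> f - g \<in> bop S"
  using bop_subspace by (rule complex_vector.subspace_diff)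

lemma opnorm_add: "f \<in> bop S \<Longrightarrow> g \<in> bop S \<Longrightarrow> opnorm S (f + g) \<le> opnorm S f + opnorm S g"
  by (rule opnorm_le) (simp_all only: add_bound opnorm_nonneg add_nonneg_nonneg)

lemma opnorm_comp: "f \<in> bop S \<Longrightarrow> g \<in> bop S \<Longrightarrow> opnorm S (f \<circ> g) \<le> opnorm S f * opnorm S g"
  by (rule opnorm_le) (simp_all only: comp_bound opnorm_nonneg mult_nonneg_nonneg)

lemma opnorm_scale: "f \<in> bop S \<Longrightarrow> opnorm S (c *\<^sub>C f) \<le> cmod c * opnorm S f"
  by (rule opnorm_le) (simp_all only: scale_bound opnorm_nonneg mult_nonneg_nonneg norm_ge_zero)

end

subsection \<open>Adjoints and closures of *-algebras\<close>

text \<open>\<open>adj\<close> is specified by \<open>THE\<close>, which yields nothing without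
  existence. Existence is isolated as a property of the space, so that the theory of adjoints can be
  developed before it is verified for direct sums.\<close>

definition adjointable :: "'a::complex_vector hspace \<Rightarrow> bool" where
  "adjointable S \<longleftrightarrow>
     (\<forall>f\<in>bop S. \<exists>g\<in>bop S. \<forall>u\<in>hcar S. \<forall>v\<in>hcar S. hip S u (g v) = hip S (f u) v)"

locale adj_space = ip_space +
  assumes adjointable: "adjointable S"
begin

lemma adj_eqI:
  assumes "g \<in> bop S" "\<And>u v. u \<in> hcar S \<Longrightarrow> v \<in> hcar S \<Longrightarrow> hip S u (g v) = hip S (f u) v"
  shows "adj S S f = g"
  unfolding adj_def
proof (rule the_equality)
  fix h assume h: "h \<in> bop S \<and> (\<forall>u\<in>hcar S. \<forall>v\<in>hcar S. hip S u (h v) = hip S (f u) v)"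
  show "h = g"
    by (rule bop_eqI) (use h assms in \<open>auto intro!: eq_if_ip_eq simp: bop_mem\<close>)
qed (use assms in auto)

lemma adj_props:
  assumes "f \<in> bop S"
  shows adj_mem: "adj S S f \<in> bop S"
    and adj_ip: "u \<in> hcar S \<Longrightarrow> v \<in> hcar S \<Longrightarrow> hip S u (adj S S f v) = hip S (f u) v"
proof -
  obtain g where g: "g \<in> bop S" "\<And>u v. u \<in> hcar S \<Longrightarrow> v \<in> hcar S \<Longrightarrow> hip S u (g v) = hip S (f u) v"
    using assms adjointable by (auto simp: adjointable_def)
  then have "adj S S f = g" by (rule adj_eqI)
  then show "adj S S f \<in> bop S"
    "u \<in> hcar S \<Longrightarrow> v \<in> hcar S \<Longrightarrow> hip S u (adj S S f v) = hip S (f u) v"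
    using g by auto
qed

lemma adj_diff:
  assumes "f \<in> bop S" "g \<in> bop S"
  shows "adj S S (f - g) = adj S S f - adj S S g"
  using assms
  by (intro adj_eqI) (simp_all add: bop_minus adj_mem ip_diff_left ip_diff_right bop_mem adj_ip)

text \<open>With \<open>w = adj S S f v\<close>, the square of the norm of \<open>w\<close> is the
  inner product of \<open>f w\<close> with \<open>v\<close>, hence at most \<open>opnorm S f\<close>
  times the norms of \<open>w\<close> and \<open>v\<close>; one factor of the norm of
  \<open>w\<close> cancels.\<close>

lemma opnorm_adj:
  assumes f: "f \<in> bop S"
  shows "opnorm S (adj S S f) \<le> opnorm S f"
proof (rule opnorm_le[OF opnorm_nonneg[OF f]])
  fix v assume v: "v \<in> hcar S"
  let ?w = "adj S S f v"
  have w: "?w \<in> hcar S" using f v by (simp add: adj_mem bop_mem)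
  have "(hnorm S ?w)\<^sup>2 = cmod (hip S ?w ?w)" using w by (simp add: ip_self norm_power)
  also have "\<dots> = cmod (hip S (f ?w) v)" using f v w by (simp add: adj_ip)
  also have "\<dots> \<le> hnorm S (f ?w) * hnorm S v" by (rule cauchy_schwarz) (simp_all add: f v w bop_mem)
  also have "\<dots> \<le> (opnorm S f * hnorm S ?w) * hnorm S v"
    by (rule mult_right_mono) (simp_all add: opnorm_bound f v w hnorm_nonneg)
  finally have *: "hnorm S ?w * hnorm S ?w \<le> hnorm S ?w * (opnorm S f * hnorm S v)"
    by (simp add: power2_eq_square mult_ac)
  show "hnorm S ?w \<le> opnorm S f * hnorm S v"
  proof (cases "hnorm S ?w = 0")
    case True
    then show ?thesis using f v by (simp add: opnorm_nonneg hnorm_nonneg)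
  next
    case False
    then show ?thesis using * hnorm_nonneg[OF w] by (simp add: mult_le_cancel_left)
  qed
qed

text \<open>Ensures that the family intersected in \<open>cstar_generated\<close> is nonempty for
  bounded generators; an empty intersection would be the set of all functions.\<close>

lemma cstar_bop: "cstar_subalgebra S (bop S)"
  by (auto simp: cstar_subalgebra_def bop_subspace bop_comp adj_mem op_closure_def)

lemma cstar_generated_cstar:
  assumes "X \<subseteq> bop S"
  shows "cstar_subalgebra S (cstar_generated S X)"
proof -
  let ?F = "{\<A>. cstar_subalgebra S \<A> \<and> X \<subseteq> \<A>}"
  have "bop S \<in> ?F" using assms cstar_bop by auto
  then have sub: "\<Inter>?F \<subseteq> bop S" by blast
  have ss: "complex_vector.subspace (\<Inter>?F)"
    by (rule complex_vector.subspace_Inter) (auto simp: cstar_subalgebra_def)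
  have cl: "op_closure S (\<Inter>?F) \<subseteq> \<Inter>?F"
  proof
    fix f assume f: "f \<in> op_closure S (\<Inter>?F)"
    have "f \<in> \<A>" if "\<A> \<in> ?F" for \<A>
    proof -
      have "f \<in> op_closure S \<A>" using f that by (fastforce simp: op_closure_def)
      then show ?thesis using that by (auto simp: cstar_subalgebra_def)
    qed
    then show "f \<in> \<Inter>?F" by blast
  qed
  show ?thesis unfolding cstar_generated_def
    using sub ss cl by (simp add: cstar_subalgebra_def)
qed

lemma subset_op_closure:
  assumes "\<A> \<subseteq> bop S"
  shows "\<A> \<subseteq> op_closure S \<A>"
proof
  fix f assume f: "f \<in> \<A>"
  have "opnorm S 0 \<le> 0" by (rule opnorm_le) simp_all
  then have "opnorm S (f - f) < e" if "e > 0" for e using that by simp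
  then show "f \<in> op_closure S \<A>" using assms f by (auto simp: op_closure_def intro!: bexI[of _ f])
qed

lemma op_closure_mono: "\<A> \<subseteq> \<B> \<Longrightarrow> op_closure S \<A> \<subseteq> op_closure S \<B>"
  unfolding op_closure_def by blast

text \<open>All *-algebra operations are continuous in the operator norm, so approximants of the
  arguments combine to approximants of the result. It is meant for an increasing union of
  subalgebras, which has the algebraic closure properties but need not be norm closed.\<close>

lemma cstar_op_closure:
  assumes sub: "\<A> \<subseteq> bop S" and ss: "complex_vector.subspace \<A>"
    and comp: "\<And>f g. f \<in> \<A> \<Longrightarrow> g \<in> \<A> \<Longrightarrow> f \<circ> g \<in> \<A>"
    and adj: "\<And>f. f \<in> \<A> \<Longrightarrow> adj S S f \<in> \<A>"
  shows "cstar_subalgebra S (op_closure S \<A>)"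
proof -
  let ?C = "op_closure S \<A>"
  have bop: "f \<in> bop S" if "f \<in> ?C" for f using that by (simp add: op_closure_def)
  have bopA: "f \<in> bop S" if "f \<in> \<A>" for f using that sub by blast
  have approx: "\<exists>g\<in>\<A>. opnorm S (f - g) < e" if "f \<in> ?C" "e > 0" for f e
    using that by (simp add: op_closure_def)
  have sup: "\<A> \<subseteq> ?C" using sub by (rule subset_op_closure)
  have closed: "op_closure S ?C \<subseteq> ?C"
  proof
    fix f assume f: "f \<in> op_closure S ?C"
    have fb: "f \<in> bop S" using f by (simp add: op_closure_def)
    have "\<exists>h\<in>\<A>. opnorm S (f - h) < e" if e: "e > 0" for e
    proof -
      obtain g where g: "g \<in> ?C" "opnorm S (f - g) < e / 2"
        using f half_gt_zero[OF e] unfolding op_closure_def[of S ?C] by blast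
      obtain h where h: "h \<in> \<A>" "opnorm S (g - h) < e / 2"
        using approx[OF g(1), of "e/2"] e by auto
      have "opnorm S (f - h) \<le> opnorm S (f - g) + opnorm S (g - h)"
        using opnorm_add[OF bop_minus[OF fb bop[OF g(1)]] bop_minus[OF bop[OF g(1)] bopA[OF h(1)]]]
        by simp
      then show ?thesis using g h by (intro bexI[of _ h]) simp_all
    qed
    then show "f \<in> ?C" using fb by (simp add: op_closure_def)
  qed
  have plus: "f + g \<in> ?C" if f: "f \<in> ?C" and g: "g \<in> ?C" for f g
  proof -
    have "\<exists>h\<in>\<A>. opnorm S (f + g - h) < e" if e: "e > 0" for e
    proof -
      obtain f' where f': "f' \<in> \<A>" "opnorm S (f - f') < e / 2" using approx[OF f, of "e/2"] e by auto
      obtain g' where g': "g' \<in> \<A>" "opnorm S (g - g') < e / 2" using approx[OF g, of "e/2"] e by auto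
      have "opnorm S (f + g - (f' + g')) \<le> opnorm S (f - f') + opnorm S (g - g')"
        using opnorm_add[OF bop_minus[OF bop[OF f] bopA[OF f'(1)]] bop_minus[OF bop[OF g] bopA[OF g'(1)]]]
        by (simp add: algebra_simps)
      then show ?thesis
        using f' g' complex_vector.subspace_add[OF ss] by (intro bexI[of _ "f' + g'"]) simp_all
    qed
    then show ?thesis using f g by (simp add: op_closure_def bop_plus)
  qed
  have scale: "c *\<^sub>C f \<in> ?C" if f: "f \<in> ?C" for c f
  proof -
    have "\<exists>h\<in>\<A>. opnorm S (c *\<^sub>C f - h) < e" if e: "e > 0" for e
    proof -
      \<comment> \<open>The summand 1 keeps the denominator positive when
        \<open>c = 0\<close>.\<close>
      obtain f' where f': "f' \<in> \<A>" "opnorm S (f - f') < e / (cmod c + 1)"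
        using approx[OF f, of "e / (cmod c + 1)"] e by (auto simp: add_nonneg_pos)
      have d: "f - f' \<in> bop S" using bop_minus bop[OF f] bopA[OF f'(1)] by simp
      have "opnorm S (c *\<^sub>C f - c *\<^sub>C f') \<le> cmod c * opnorm S (f - f')"
        using opnorm_scale[OF d] by (simp add: complex_vector.scale_right_diff_distrib)
      also have "\<dots> \<le> (cmod c + 1) * opnorm S (f - f')"
        using opnorm_nonneg[OF d] by (intro mult_right_mono) simp_all
      also have "\<dots> < e"
        using f'(2) by (simp add: pos_less_divide_eq add_nonneg_pos mult.commute)
      finally show ?thesis
        using f' complex_vector.subspace_scale[OF ss] by (intro bexI[of _ "c *\<^sub>C f'"]) simp_all
    qed
    then show ?thesis using f by (simp add: op_closure_def bop_scaleC)
  qed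
  have times: "f \<circ> g \<in> ?C" if f: "f \<in> ?C" and g: "g \<in> ?C" for f g
  proof -
    have "\<exists>h\<in>\<A>. opnorm S ((f \<circ> g) - h) < e" if e: "e > 0" for e
    proof -
      \<comment> \<open>\<open>M\<close> strictly exceeds both norms. The choice of \<open>d\<close>
        below has two purposes: \<open>d \<le> 1\<close> bounds the norm of the approximant
        \<open>f'\<close> by \<open>M + M\<close>, and the total error
        \<open>d * M + (M + M) * d\<close> is then \<open>3 * M * d \<le> e\<close>.\<close>
      define M where "M = opnorm S g + opnorm S f + 1"
      have M: "M > 0" "opnorm S f < M" "opnorm S g < M"
        using opnorm_nonneg[OF bop[OF f]] opnorm_nonneg[OF bop[OF g]] by (simp_all add: M_def)
      define d where "d = min 1 (e / (3 * M))"
      have d: "d > 0" "d \<le> 1" "3 * M * d \<le> e"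
      proof -
        show "d > 0" "d \<le> 1" using e M by (simp_all add: d_def)
        have "d \<le> e / (3 * M)" by (simp add: d_def)
        then show "3 * M * d \<le> e" using M(1) by (simp add: field_simps)
      qed
      obtain f' where f': "f' \<in> \<A>" "opnorm S (f - f') < d" using approx[OF f d(1)] by auto
      obtain g' where g': "g' \<in> \<A>" "opnorm S (g - g') < d" using approx[OF g d(1)] by auto
      note b = bop[OF f] bop[OF g] bopA[OF f'(1)] bopA[OF g'(1)]
      have df: "f - f' \<in> bop S" and dg: "g - g' \<in> bop S" using b by (simp_all add: bop_minus)
      have nf': "opnorm S f' \<le> M + M"
      proof -
        have "opnorm S f' \<le> opnorm S f + opnorm S ((-1) *\<^sub>C (f - f'))"
          using opnorm_add[OF b(1) bop_scaleC[OF df, of "-1"]] by simp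
        also have "opnorm S ((-1) *\<^sub>C (f - f')) \<le> opnorm S (f - f')"
          using opnorm_scale[OF df, of "-1"] by simp
        finally show ?thesis using f'(2) d(2) M opnorm_nonneg[OF b(1)] opnorm_nonneg[OF b(2)]
          by (simp add: M_def)
      qed
      \<comment> \<open>The usual splitting of a difference of products. It uses linearity of
        \<open>f'\<close> on the carrier; off the carrier both sides are zero.\<close>
      have "(f \<circ> g) - (f' \<circ> g') = ((f - f') \<circ> g) + (f' \<circ> (g - g'))"
      proof
        fix v show "((f \<circ> g) - (f' \<circ> g')) v = (((f - f') \<circ> g) + (f' \<circ> (g - g'))) v"
          using b by (cases "v \<in> hcar S") (simp_all add: bop_diff bop_mem bop_off bop_zero)
      qed
      then have "opnorm S ((f \<circ> g) - (f' \<circ> g')) \<le> opnorm S ((f - f') \<circ> g) + opnorm S (f' \<circ> (g - g'))"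
        using opnorm_add[OF bop_comp[OF df b(2)] bop_comp[OF b(3) dg]] by simp
      also have "\<dots> \<le> opnorm S (f - f') * opnorm S g + opnorm S f' * opnorm S (g - g')"
        by (intro add_mono opnorm_comp df dg b)
      also have "\<dots> \<le> opnorm S (f - f') * M + (M + M) * opnorm S (g - g')"
        using M nf' opnorm_nonneg df dg b by (intro add_mono mult_mono) auto
      also have "\<dots> < d * M + (M + M) * d"
        using M f'(2) g'(2) by (intro add_strict_mono) simp_all
      finally show ?thesis
        using comp[OF f'(1) g'(1)] d(3) by (intro bexI[of _ "f' \<circ> g'"]) (simp_all add: algebra_simps)
    qed
    then show ?thesis using f g by (simp add: op_closure_def bop_comp)
  qed
  have adjc: "adj S S f \<in> ?C" if f: "f \<in> ?C" for f
  proof -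
    have "\<exists>h\<in>\<A>. opnorm S (adj S S f - h) < e" if e: "e > 0" for e
    proof -
      obtain f' where f': "f' \<in> \<A>" "opnorm S (f - f') < e" using approx[OF f e] by auto
      have "opnorm S (adj S S f - adj S S f') \<le> opnorm S (f - f')"
        using opnorm_adj[OF bop_minus[OF bop[OF f] bopA[OF f'(1)]]] bop[OF f] bopA[OF f'(1)]
        by (simp add: adj_diff)
      then show ?thesis using f'(2) adj[OF f'(1)] by (intro bexI[of _ "adj S S f'"]) simp_all
    qed
    then show ?thesis using f by (simp add: op_closure_def adj_mem)
  qed
  have "complex_vector.subspace ?C"
    using plus scale sup complex_vector.subspace_0[OF ss] by (intro complex_vector.subspaceI) auto
  then show ?thesis
    using closed times adjc bop by (auto simp: cstar_subalgebra_def)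
qed

end


subsection \<open>Finite-dimensional spaces\<close>

context ip_space
begin

text \<open>The spanning set in \<open>finite_dim\<close> may leave the carrier, where the inner
  product is meaningless, so it is not orthonormalised directly. Instead it bounds the size of
  orthonormal sets, which are independent, and one of maximal size is taken: a vector different from
  its expansion would leave a nonzero remainder that, normalised, enlarges the set.\<close>

lemma finite_onb:
  assumes "finite_dim (hcar S)"
  obtains B where "finite B" "B \<subseteq> hcar S"
    "\<And>u v. u \<in> B \<Longrightarrow> v \<in> B \<Longrightarrow> hip S u v = (if u = v then 1 else 0)"
    "\<And>v. v \<in> hcar S \<Longrightarrow> v = (\<Sum>b\<in>B. hip S b v *\<^sub>C b)"
proof -
  obtain B0 where B0: "finite B0" "hcar S \<subseteq> complex_vector.span B0"
    using assms by (auto simp: finite_dim_def)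
  define ON where "ON B \<longleftrightarrow> finite B \<and> B \<subseteq> hcar S \<and>
    (\<forall>u\<in>B. \<forall>v\<in>B. hip S u v = (if u = v then 1 else 0))" for B
  \<comment> \<open>Pairing with \<open>b\<close> reads off a coefficient. This gives independence
    of orthonormal sets and, later, orthogonality of the remainder.\<close>
  have coeff: "hip S b (\<Sum>u\<in>B. c u *\<^sub>C u) = c b" if B: "ON B" and b: "b \<in> B" for B b c
  proof -
    have Bc: "u \<in> hcar S" if "u \<in> B" for u using B that by (auto simp: ON_def)
    have "hip S b (\<Sum>u\<in>B. c u *\<^sub>C u) = (\<Sum>u\<in>B. c u * hip S b u)"
      using Bc b by (simp add: ip_sum_right scale_mem ip_scale_right)
    also have "\<dots> = (\<Sum>u\<in>B. if b = u then c u else 0)"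
      using B b by (intro sum.cong) (auto simp: ON_def)
    finally show ?thesis using B b by (simp add: ON_def)
  qed
  have bound: "card B \<le> card B0" if B: "ON B" for B
  proof -
    have "complex_vector.independent B"
    proof
      assume "complex_vector.dependent B"
      then obtain c v where "v \<in> B" "c v \<noteq> 0" "(\<Sum>v\<in>B. c v *\<^sub>C v) = 0"
        using complex_vector.dependent_finite[of B] B by (auto simp: ON_def)
      then show False using coeff[OF B, of v c] B by (auto simp: ON_def)
    qed
    moreover have "B \<subseteq> complex_vector.span B0" using B B0 by (auto simp: ON_def)
    ultimately show ?thesis using complex_vector.independent_span_bound[OF B0(1)] by blast
  qed
  obtain B where B: "ON B" and max: "\<And>B'. ON B' \<Longrightarrow> card B' \<le> card B"
  proof -
    have "ON {}" by (simp add: ON_def)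
    then show ?thesis
      using ex_has_greatest_nat[of ON "{}" card "Suc (card B0)"] bound that by (auto simp: less_Suc_eq_le)
  qed
  have Bc: "finite B" "B \<subseteq> hcar S"
    and orth: "\<And>u v. u \<in> B \<Longrightarrow> v \<in> B \<Longrightarrow> hip S u v = (if u = v then 1 else 0)"
    using B unfolding ON_def by blast+
  have "v = (\<Sum>b\<in>B. hip S b v *\<^sub>C b)" if v: "v \<in> hcar S" for v
  proof (rule ccontr)
    assume neq: "v \<noteq> (\<Sum>b\<in>B. hip S b v *\<^sub>C b)"
    let ?s = "\<Sum>b\<in>B. hip S b v *\<^sub>C b"
    have s: "?s \<in> hcar S" using Bc by (intro sum_mem scale_mem) auto
    define w where "w = v - ?s"
    have w: "w \<in> hcar S" using v s by (simp add: w_def diff_mem)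
    have n: "hnorm S w \<noteq> 0" using hnorm_eq_0D[OF w] neq by (auto simp: w_def)
    have bw: "hip S b w = 0" if "b \<in> B" for b
      using that Bc coeff[OF B that] by (auto simp: w_def ip_diff_right v s)
    define u where "u = of_real (inverse (hnorm S w)) *\<^sub>C w"
    have u: "u \<in> hcar S" using w by (simp add: u_def scale_mem)
    have uu: "hip S u u = 1"
    proof -
      have "hnorm S u = 1"
        using n hnorm_nonneg[OF w] by (simp add: u_def hnorm_scale[OF w] norm_inverse)
      then show ?thesis by (simp add: ip_self[OF u])
    qed
    have bu: "hip S b u = 0" "hip S u b = 0" if "b \<in> B" for b
    proof -
      show "hip S b u = 0" using that bw Bc w by (auto simp: u_def ip_scale_right)
      then show "hip S u b = 0" using herm[of b u] that Bc u by auto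
    qed
    have nB: "u \<notin> B" using bu uu by auto
    have "hip S a b = (if a = b then 1 else 0)" if "a \<in> insert u B" "b \<in> insert u B" for a b
      using that uu bu orth[of a b] nB by (cases "a = u"; cases "b = u") auto
    then have "ON (insert u B)" using Bc u unfolding ON_def by blast
    then show False using max[of "insert u B"] Bc nB by simp
  qed
  with Bc orth show ?thesis by (rule that)
qed

lemma riesz_finite_dim:
  assumes "finite_dim (hcar S)" and \<phi>: "clinear_on (hcar S) \<phi>"
  obtains r where "r \<in> hcar S" "\<And>u. u \<in> hcar S \<Longrightarrow> hip S r u = \<phi> u"
proof -
  obtain B where B: "finite B" "B \<subseteq> hcar S"
    "\<And>v. v \<in> hcar S \<Longrightarrow> v = (\<Sum>b\<in>B. hip S b v *\<^sub>C b)"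
    by (rule finite_onb[OF assms(1)]) blast
  \<comment> \<open>The coefficients are conjugated because the inner product is conjugate-linear in
    its first argument, where \<open>r\<close> will stand.\<close>
  define r where "r = (\<Sum>b\<in>B. cnj (\<phi> b) *\<^sub>C b)"
  have r: "r \<in> hcar S" unfolding r_def using B by (intro sum_mem scale_mem) auto
  have \<phi>0: "\<phi> 0 = 0"
  proof -
    have "\<phi> (0 + 0) = \<phi> 0 + \<phi> 0" using \<phi> zero_mem unfolding clinear_on_def by blast
    then show ?thesis by simp
  qed
  have \<phi>sum: "\<phi> (\<Sum>b\<in>C. c b *\<^sub>C b) = (\<Sum>b\<in>C. c b * \<phi> b)" if "finite C" "C \<subseteq> hcar S" for C c
    using that
  proof (induction C)
    case (insert b C)
    then have b: "b \<in> hcar S" and C: "(\<Sum>b\<in>C. c b *\<^sub>C b) \<in> hcar S"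
      by (auto intro!: sum_mem scale_mem)
    have "\<phi> (c b *\<^sub>C b + (\<Sum>b\<in>C. c b *\<^sub>C b)) = \<phi> (c b *\<^sub>C b) + \<phi> (\<Sum>b\<in>C. c b *\<^sub>C b)"
      using \<phi> scale_mem[OF b] C unfolding clinear_on_def by blast
    also have "\<phi> (c b *\<^sub>C b) = c b * \<phi> b"
      using \<phi> b unfolding clinear_on_def scaleC_complex_def by blast
    finally show ?case using insert by simp
  qed (simp add: \<phi>0)
  have "hip S r u = \<phi> u" if u: "u \<in> hcar S" for u
  proof -
    have "hip S r u = (\<Sum>b\<in>B. hip S (cnj (\<phi> b) *\<^sub>C b) u)"
      unfolding r_def using B u by (intro ip_sum_left) (auto intro: scale_mem)
    also have "\<dots> = (\<Sum>b\<in>B. hip S b u * \<phi> b)"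
      using B u by (intro sum.cong) (auto simp: ip_scale_left)
    also have "\<dots> = \<phi> (\<Sum>b\<in>B. hip S b u *\<^sub>C b)" using \<phi>sum[OF B(1,2)] by simp
    also have "\<dots> = \<phi> u" using B(3)[OF u] by simp
    finally show ?thesis .
  qed
  with r show ?thesis by (rule that)
qed

end

lemma hilbert_space_ip_space:
  assumes "hilbert_space S"
  shows "ip_space S"
proof -
  have *: "complex_vector.subspace (hcar S)"
    "\<forall>u\<in>hcar S. clinear_on (hcar S) (hip S u)"
    "\<forall>u\<in>hcar S. \<forall>v\<in>hcar S. hip S v u = cnj (hip S u v)"
    "\<forall>u\<in>hcar S. hip S u u \<in> \<real>\<^sub>\<ge>\<^sub>0"
    "\<forall>u\<in>hcar S. hip S u u = 0 \<longrightarrow> u = 0"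
    using assms unfolding hilbert_space_def by - (elim conjE, assumption)+
  show ?thesis by unfold_locales (use * in blast)+
qed

subsection \<open>Direct sums of finite-dimensional spaces\<close>

text \<open>The coordinate projection onto the summands indexed by \<open>V\<close>, as a map on all
  families. Unlike the elements of \<open>bop\<close>, it is not forced to vanish off the carrier of
  the direct sum.\<close>

definition zero_off :: "'v set \<Rightarrow> ('v \<Rightarrow> 'a::zero) \<Rightarrow> 'v \<Rightarrow> 'a" where
  "zero_off V v = (\<lambda>x. if x \<in> V then v x else 0)"

definition single :: "'v \<Rightarrow> 'a::zero \<Rightarrow> 'v \<Rightarrow> 'a" where
  "single x a = (\<lambda>z. if z = x then a else 0)"

lemma scaleC_fun_apply: "(c *\<^sub>C f) x = c *\<^sub>C f x"
  by (simp add: scaleC_fun_def)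

lemma single_add: "single x (a + b :: 'a::comm_monoid_add) = single x a + single x b"
  by (auto simp: single_def fun_eq_iff)

lemma single_scale: "single x (c *\<^sub>C a) = c *\<^sub>C single x a"
  by (auto simp: single_def fun_eq_iff scaleC_fun_def)

lemma sum_fun: "(\<Sum>i\<in>I. f i) x = (\<Sum>i\<in>I. f i x)"
  by (induction I rule: infinite_finite_induct) simp_all

lemma zero_off_eq_sum_single:
  fixes v :: "'v \<Rightarrow> 'a::comm_monoid_add"
  assumes "finite V"
  shows "zero_off V v = (\<Sum>x\<in>V. single x (v x))"
  using assms by (auto simp: fun_eq_iff sum_fun zero_off_def single_def)

locale hilbert_family =
  fixes X :: "'v set" and H :: "'v \<Rightarrow> 'a::complex_vector hspace"
  assumes ip_space: "x \<in> X \<Longrightarrow> ip_space (H x)"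
    and finite_dim: "x \<in> X \<Longrightarrow> finite_dim (hcar (H x))"
begin

abbreviation "D \<equiv> direct_sum X H"

lemma mem_iff:
  "v \<in> hcar D \<longleftrightarrow> (\<forall>x\<in>X. v x \<in> hcar (H x)) \<and> (\<forall>x. x \<notin> X \<longrightarrow> v x = 0) \<and>
     (\<lambda>x. (hnorm (H x) (v x))\<^sup>2) summable_on X"
  by (simp add: direct_sum_def)

lemma memD:
  assumes "v \<in> hcar D"
  shows mem_component: "x \<in> X \<Longrightarrow> v x \<in> hcar (H x)"
    and mem_off: "x \<notin> X \<Longrightarrow> v x = 0"
    and mem_summable: "(\<lambda>x. (hnorm (H x) (v x))\<^sup>2) summable_on X"
  using assms by (simp_all add: mem_iff)

lemma hip_eq: "hip D u v = (\<Sum>\<^sub>\<infinity>x\<in>X. hip (H x) (u x) (v x))"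
  by (simp add: direct_sum_def)

text \<open>Cauchy-Schwarz in every summand, followed by
  \<open>a * b \<le> a\<^sup>2 + b\<^sup>2\<close> for nonnegative \<open>a\<close> and
  \<open>b\<close>, reduces absolute summability to square summability.\<close>

lemma hip_summable:
  assumes "u \<in> hcar D" "v \<in> hcar D"
  shows "(\<lambda>x. hip (H x) (u x) (v x)) summable_on X"
proof (rule Infinite_Sum.abs_summable_summable, rule Infinite_Sum.abs_summable_on_comparison_test')
  show "(\<lambda>x. (hnorm (H x) (u x))\<^sup>2 + (hnorm (H x) (v x))\<^sup>2) summable_on X"
    using assms by (intro summable_on_add mem_summable)
  fix x assume x: "x \<in> X"
  interpret ip_space "H x" using x by (rule ip_space)
  have "cmod (hip (H x) (u x) (v x)) \<le> hnorm (H x) (u x) * hnorm (H x) (v x)"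
    using assms x by (intro cauchy_schwarz mem_component)
  also have "\<dots> \<le> (hnorm (H x) (u x))\<^sup>2 + (hnorm (H x) (v x))\<^sup>2"
    using sum_squares_bound[of "hnorm (H x) (u x)" "hnorm (H x) (v x)"]
      mult_nonneg_nonneg[OF hnorm_nonneg[of "u x"] hnorm_nonneg[of "v x"]] assms x
    by (simp add: mem_component)
  finally show "cmod (hip (H x) (u x) (v x)) \<le> (hnorm (H x) (u x))\<^sup>2 + (hnorm (H x) (v x))\<^sup>2" .
qed

text \<open>Turns a complex infinite sum into a real one with nonnegative terms, from which
  positivity and definiteness on the direct sum are read off.\<close>

lemma hip_self:
  assumes "u \<in> hcar D"
  shows "hip D u u = of_real (\<Sum>\<^sub>\<infinity>x\<in>X. (hnorm (H x) (u x))\<^sup>2)"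
proof -
  have "((\<lambda>x. complex_of_real ((hnorm (H x) (u x))\<^sup>2)) has_sum
      of_real (\<Sum>\<^sub>\<infinity>x\<in>X. (hnorm (H x) (u x))\<^sup>2)) X"
    using assms by (intro has_sum_of_real has_sum_infsum mem_summable)
  moreover have "hip D u u = (\<Sum>\<^sub>\<infinity>x\<in>X. complex_of_real ((hnorm (H x) (u x))\<^sup>2))"
    unfolding hip_eq
    using assms by (intro infsum_cong ip_space.ip_self ip_space) (simp_all add: mem_component)
  ultimately show ?thesis using infsumI by metis
qed

sublocale ip_space D
proof
  show "complex_vector.subspace (hcar D)"
  proof (rule complex_vector.subspaceI)
    show "0 \<in> hcar D"
    proof -
      have "(hnorm (H x) 0)\<^sup>2 = 0" "0 \<in> hcar (H x)" if "x \<in> X" for x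
        using ip_space[OF that] by (simp_all add: ip_space.hnorm_zero ip_space.zero_mem)
      then show ?thesis using summable_on_cong[of X "\<lambda>x. (hnorm (H x) 0)\<^sup>2" "\<lambda>_. 0"] by (simp add: mem_iff)
    qed
    show "u + v \<in> hcar D" if u: "u \<in> hcar D" and v: "v \<in> hcar D" for u v
    proof -
      have "(\<lambda>x. (hnorm (H x) (u x + v x))\<^sup>2) summable_on X"
      proof (rule summable_on_comparison_test)
        \<comment> \<open>The majorant comes from the triangle inequality in each summand and
          \<open>(a + b)\<^sup>2 \<le> 2 * (a\<^sup>2 + b\<^sup>2)\<close>.\<close>
        show "(\<lambda>x. 2 * ((hnorm (H x) (u x))\<^sup>2 + (hnorm (H x) (v x))\<^sup>2)) summable_on X"
          using u v by (intro summable_on_cmult_right summable_on_add mem_summable)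
        fix x assume x: "x \<in> X"
        interpret ip_space "H x" using x by (rule ip_space)
        have c: "u x \<in> hcar (H x)" "v x \<in> hcar (H x)" using u v x by (simp_all add: mem_component)
        have "(hnorm (H x) (u x + v x))\<^sup>2 \<le> (hnorm (H x) (u x) + hnorm (H x) (v x))\<^sup>2"
          using c by (intro power_mono hnorm_triangle hnorm_nonneg add_mem)
        also have "\<dots> \<le> 2 * ((hnorm (H x) (u x))\<^sup>2 + (hnorm (H x) (v x))\<^sup>2)"
          using sum_squares_bound[of "hnorm (H x) (u x)" "hnorm (H x) (v x)"] by (simp add: power2_sum)
        finally show "(hnorm (H x) (u x + v x))\<^sup>2 \<le> 2 * ((hnorm (H x) (u x))\<^sup>2 + (hnorm (H x) (v x))\<^sup>2)" .
      qed simp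
      then show ?thesis
        using u v by (simp add: mem_iff ip_space.add_mem[OF ip_space])
    qed
    show "c *\<^sub>C u \<in> hcar D" if u: "u \<in> hcar D" for c u
    proof -
      have "(\<lambda>x. (cmod c)\<^sup>2 * (hnorm (H x) (u x))\<^sup>2) summable_on X"
        using u by (intro summable_on_cmult_right mem_summable)
      moreover have "(hnorm (H x) (c *\<^sub>C u x))\<^sup>2 = (cmod c)\<^sup>2 * (hnorm (H x) (u x))\<^sup>2" if "x \<in> X" for x
        using u that by (simp add: ip_space.hnorm_scale[OF ip_space] mem_component power_mult_distrib)
      ultimately have "(\<lambda>x. (hnorm (H x) (c *\<^sub>C u x))\<^sup>2) summable_on X"
        by (simp cong: summable_on_cong)
      then show ?thesis
        using u by (simp add: mem_iff scaleC_fun_def ip_space.scale_mem[OF ip_space])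
    qed
  qed
next
  fix u assume u: "u \<in> hcar D"
  show "clinear_on (hcar D) (hip D u)"
    unfolding clinear_on_def
  proof (intro conjI ballI allI)
    fix v w assume v: "v \<in> hcar D" and w: "w \<in> hcar D"
    have "hip D u (v + w) = (\<Sum>\<^sub>\<infinity>x\<in>X. hip (H x) (u x) (v x) + hip (H x) (u x) (w x))"
      unfolding hip_eq
      using u v w by (intro infsum_cong) (simp add: ip_space.ip_add_right[OF ip_space] mem_component)
    then show "hip D u (v + w) = hip D u v + hip D u w"
      using u v w by (simp add: infsum_add hip_summable hip_eq)
  next
    fix c v assume v: "v \<in> hcar D"
    have "hip D u (c *\<^sub>C v) = (\<Sum>\<^sub>\<infinity>x\<in>X. c * hip (H x) (u x) (v x))"
      unfolding hip_eq
      using u v by (intro infsum_cong)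
        (simp add: ip_space.ip_scale_right[OF ip_space] mem_component scaleC_fun_def)
    then show "hip D u (c *\<^sub>C v) = c *\<^sub>C hip D u v"
      by (simp add: infsum_cmult_right' hip_eq scaleC_complex_def)
  qed
next
  fix u v assume u: "u \<in> hcar D" and v: "v \<in> hcar D"
  show "hip D v u = cnj (hip D u v)"
    unfolding hip_eq infsum_cnj[symmetric]
    using u v by (intro infsum_cong ip_space.herm ip_space mem_component)
next
  fix u assume u: "u \<in> hcar D"
  have nn: "0 \<le> (\<Sum>\<^sub>\<infinity>x\<in>X. (hnorm (H x) (u x))\<^sup>2)" by (rule infsum_nonneg) simp
  then show "hip D u u \<in> \<real>\<^sub>\<ge>\<^sub>0" using u by (simp add: hip_self)
  assume "hip D u u = 0"
  then have "(\<Sum>\<^sub>\<infinity>x\<in>X. (hnorm (H x) (u x))\<^sup>2) = 0" using u by (simp add: hip_self)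
  then have "hnorm (H x) (u x) = 0" if "x \<in> X" for x
    using nonneg_infsum_le_0D[OF _ mem_summable[OF u] _ that] by simp
  then have "u x = 0" for x
    using u ip_space.hnorm_eq_0D[OF ip_space] by (cases "x \<in> X") (auto simp: mem_component mem_off)
  then show "u = 0" by (simp add: fun_eq_iff)
qed

section \<open>Finitely supported vectors and coordinate projections\<close>

lemma hnorm_sq_eq: "u \<in> hcar D \<Longrightarrow> (hnorm D u)\<^sup>2 = (\<Sum>\<^sub>\<infinity>x\<in>X. (hnorm (H x) (u x))\<^sup>2)"
  by (simp add: hnorm_sq hip_self)

lemma finite_support_mem:
  assumes "finite V" "V \<subseteq> X" "\<And>x. x \<in> V \<Longrightarrow> v x \<in> hcar (H x)" "\<And>x. x \<notin> V \<Longrightarrow> v x = 0"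
  shows "v \<in> hcar D" and "(hnorm D v)\<^sup>2 = (\<Sum>x\<in>V. (hnorm (H x) (v x))\<^sup>2)"
proof -
  have z: "0 \<in> hcar (H x)" "hnorm (H x) 0 = 0" if "x \<in> X" for x
    using ip_space[OF that] by (simp_all add: ip_space.hnorm_zero ip_space.zero_mem)
  have "(\<lambda>x. (hnorm (H x) (v x))\<^sup>2) summable_on X \<longleftrightarrow> (\<lambda>x. (hnorm (H x) (v x))\<^sup>2) summable_on V"
    using assms z by (intro summable_on_cong_neutral) auto
  then have "(\<lambda>x. (hnorm (H x) (v x))\<^sup>2) summable_on X" using assms(1) by simp
  moreover have "v x \<in> hcar (H x)" if "x \<in> X" for x
    using assms z that by (cases "x \<in> V") auto
  ultimately show v: "v \<in> hcar D" using assms by (auto simp: mem_iff)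
  have "(\<Sum>\<^sub>\<infinity>x\<in>X. (hnorm (H x) (v x))\<^sup>2) = (\<Sum>\<^sub>\<infinity>x\<in>V. (hnorm (H x) (v x))\<^sup>2)"
    using assms z by (intro infsum_cong_neutral) auto
  then show "(hnorm D v)\<^sup>2 = (\<Sum>x\<in>V. (hnorm (H x) (v x))\<^sup>2)"
    using assms(1) by (simp add: hnorm_sq_eq[OF v])
qed

lemma single_mem:
  assumes "x \<in> X" "a \<in> hcar (H x)"
  shows "single x a \<in> hcar D" and "hnorm D (single x a) = hnorm (H x) a"
proof -
  have *: "single x a \<in> hcar D" "(hnorm D (single x a))\<^sup>2 = (\<Sum>z\<in>{x}. (hnorm (H z) (single x a z))\<^sup>2)"
    by (rule finite_support_mem[of "{x}"]; use assms in \<open>simp add: single_def\<close>)+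
  then show "single x a \<in> hcar D" by simp
  show "hnorm D (single x a) = hnorm (H x) a"
    using * assms ip_space.hnorm_nonneg[OF ip_space] by (simp add: hnorm_nonneg single_def)
qed

lemma zero_off_mem:
  assumes v: "v \<in> hcar D"
  shows "zero_off V v \<in> hcar D" and "(hnorm D (zero_off V v))\<^sup>2 = (\<Sum>\<^sub>\<infinity>x\<in>X \<inter> V. (hnorm (H x) (v x))\<^sup>2)"
proof -
  have z: "0 \<in> hcar (H x)" "hnorm (H x) 0 = 0" if "x \<in> X" for x
    using ip_space[OF that] by (simp_all add: ip_space.hnorm_zero ip_space.zero_mem)
  have "(\<lambda>x. (hnorm (H x) (v x))\<^sup>2) summable_on (X \<inter> V)"
    using mem_summable[OF v] by (rule summable_on_subset_banach) simp
  moreover have "(\<lambda>x. (hnorm (H x) (zero_off V v x))\<^sup>2) summable_on X \<longleftrightarrow>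
      (\<lambda>x. (hnorm (H x) (v x))\<^sup>2) summable_on (X \<inter> V)"
    using z by (intro summable_on_cong_neutral) (auto simp: zero_off_def)
  ultimately show c: "zero_off V v \<in> hcar D"
    using v z by (auto simp: mem_iff zero_off_def)
  show "(hnorm D (zero_off V v))\<^sup>2 = (\<Sum>\<^sub>\<infinity>x\<in>X \<inter> V. (hnorm (H x) (v x))\<^sup>2)"
    unfolding hnorm_sq_eq[OF c] using z by (intro infsum_cong_neutral) (auto simp: zero_off_def)
qed

text \<open>Projecting only drops nonnegative terms from the sum of squares.\<close>

lemma hnorm_zero_off_le:
  assumes v: "v \<in> hcar D"
  shows "hnorm D (zero_off V v) \<le> hnorm D v"
proof (rule power2_le_imp_le)
  show "(hnorm D (zero_off V v))\<^sup>2 \<le> (hnorm D v)\<^sup>2"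
    unfolding zero_off_mem(2)[OF v] hnorm_sq_eq[OF v]
    using mem_summable[OF v] summable_on_subset_banach[OF mem_summable[OF v], of "X \<inter> V"]
    by (intro infsum_mono2) auto
qed (rule hnorm_nonneg[OF v])

lemma hnorm_component_le:
  assumes v: "v \<in> hcar D" and x: "x \<in> X"
  shows "hnorm (H x) (v x) \<le> hnorm D v"
proof -
  have "zero_off {x} v = single x (v x)" by (auto simp: zero_off_def single_def)
  then show ?thesis using hnorm_zero_off_le[OF v, of "{x}"] single_mem(2)[OF x mem_component[OF v x]] by simp
qed

lemma zero_off_selfadjoint: "hip D u (zero_off V v) = hip D (zero_off V u) v" if "u \<in> hcar D" "v \<in> hcar D"
  unfolding hip_eq
proof (rule infsum_cong)
  fix x assume x: "x \<in> X"
  then interpret ip_space "H x" by (rule ip_space)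
  show "hip (H x) (u x) (zero_off V v x) = hip (H x) (zero_off V u x) (v x)"
    using that x by (auto simp: zero_off_def mem_component)
qed

text \<open>The square of the error is the tail of a convergent sum. Along the net of finite
  subsets, identities known for finitely supported vectors extend to all vectors.\<close>

lemma zero_off_tendsto:
  assumes v: "v \<in> hcar D"
  shows "((\<lambda>V. hnorm D (v - zero_off V v)) \<longlongrightarrow> 0) (finite_subsets_at_top X)"
proof -
  let ?a = "\<lambda>x. (hnorm (H x) (v x))\<^sup>2"
  have eq: "hnorm D (v - zero_off V v) = sqrt (infsum ?a X - sum ?a V)" if "finite V" "V \<subseteq> X" for V
  proof -
    have "v - zero_off V v = zero_off (X - V) v" using v by (auto simp: zero_off_def fun_eq_iff mem_off)
    then have "(hnorm D (v - zero_off V v))\<^sup>2 = infsum ?a (X - V)"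
      using zero_off_mem(2)[OF v, of "X - V"] by (simp add: Int_absorb1)
    also have "\<dots> = infsum ?a X - sum ?a V"
      using that mem_summable[OF v] by (subst infsum_Diff) simp_all
    finally have "(hnorm D (v - zero_off V v))\<^sup>2 = infsum ?a X - sum ?a V" .
    then show ?thesis
      by (rule real_sqrt_unique[OF _ hnorm_nonneg[OF diff_mem[OF v zero_off_mem(1)[OF v]]], symmetric])
  qed
  have "((\<lambda>V. sqrt (infsum ?a X - sum ?a V)) \<longlongrightarrow> sqrt (infsum ?a X - infsum ?a X)) (finite_subsets_at_top X)"
    by (intro tendsto_intros infsum_tendsto mem_summable v)
  moreover have "\<forall>\<^sub>F V in finite_subsets_at_top X. sqrt (infsum ?a X - sum ?a V) = hnorm D (v - zero_off V v)"
    using eq by (intro eventually_finite_subsets_at_top_weakI) simp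
  ultimately show ?thesis by (auto intro: Lim_transform_eventually)
qed

text \<open>The adjoint of \<open>f\<close> is built componentwise: at \<open>x\<close> it represents the functional
  \<open>\<lambda>a. hip D v (f (single x a))\<close> on the finite-dimensional space \<open>H x\<close>. Hence completeness
  of the direct sum is not needed.\<close>
lemma adjointable_direct_sum: "adjointable D"
  unfolding adjointable_def
proof
  fix f assume f: "f \<in> bop D"
  define c where "c = opnorm D f"
  have c: "c \<ge> 0" "\<And>v. v \<in> hcar D \<Longrightarrow> hnorm D (f v) \<le> c * hnorm D v"
    using f by (simp_all add: c_def opnorm_nonneg opnorm_bound)
  have ex: "\<exists>r. r \<in> hcar (H x) \<and> (\<forall>a\<in>hcar (H x). hip (H x) r a = hip D v (f (single x a)))"
    if v: "v \<in> hcar D" and x: "x \<in> X" for v x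
  proof -
    have "clinear_on (hcar (H x)) (\<lambda>a. hip D v (f (single x a)))"
      unfolding clinear_on_def
    proof (intro conjI ballI allI)
      fix a b assume a: "a \<in> hcar (H x)" and b: "b \<in> hcar (H x)"
      note m = single_mem(1)[OF x a] single_mem(1)[OF x b]
      show "hip D v (f (single x (a + b))) = hip D v (f (single x a)) + hip D v (f (single x b))"
        unfolding single_add bop_add[OF f m] by (rule ip_add_right[OF v bop_mem[OF f m(1)] bop_mem[OF f m(2)]])
    next
      fix c a assume "a \<in> hcar (H x)"
      then have m: "single x a \<in> hcar D" by (rule single_mem(1)[OF x])
      show "hip D v (f (single x (c *\<^sub>C a))) = c *\<^sub>C hip D v (f (single x a))"
        unfolding single_scale bop_scale[OF f m] scaleC_complex_def by (rule ip_scale_right[OF v bop_mem[OF f m]])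
    qed
    then obtain r where "r \<in> hcar (H x)" "\<And>a. a \<in> hcar (H x) \<Longrightarrow> hip (H x) r a = hip D v (f (single x a))"
      by (rule ip_space.riesz_finite_dim[OF ip_space[OF x] finite_dim[OF x]]) blast
    then show ?thesis by blast
  qed
  define r where "r v x = (SOME r. r \<in> hcar (H x) \<and>
    (\<forall>a\<in>hcar (H x). hip (H x) r a = hip D v (f (single x a))))" for v x
  have r: "r v x \<in> hcar (H x)" "\<And>a. a \<in> hcar (H x) \<Longrightarrow> hip (H x) (r v x) a = hip D v (f (single x a))"
    if "v \<in> hcar D" "x \<in> X" for v x
    using someI_ex[OF ex[OF that]] unfolding r_def by blast+
  define g where "g v = (\<lambda>x. if v \<in> hcar D \<and> x \<in> X then r v x else 0)" for v
  \<comment> \<open>On a finite set of coordinates the representing vectors already satisfy the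
    adjoint identity, because the projected vector is a finite sum of vectors
    \<open>single x (u x)\<close>.\<close>
  have partial: "(\<Sum>x\<in>V. hip (H x) (r v x) (u x)) = hip D v (f (zero_off V u))"
    if v: "v \<in> hcar D" and V: "finite V" "V \<subseteq> X" and u: "\<And>x. x \<in> X \<Longrightarrow> u x \<in> hcar (H x)" for v V u
  proof -
    have s: "single x (u x) \<in> hcar D" if "x \<in> V" for x using that V u by (auto intro: single_mem)
    have "(\<Sum>x\<in>V. hip (H x) (r v x) (u x)) = (\<Sum>x\<in>V. hip D v (f (single x (u x))))"
      using v V u by (intro sum.cong) (auto simp: r)
    also have "\<dots> = hip D v (f (zero_off V u))"
      using v V f s by (simp add: zero_off_eq_sum_single bop_sum ip_sum_right bop_mem)
    finally show ?thesis .
  qed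
  \<comment> \<open>Apply \<open>partial\<close> to the family \<open>r v\<close> itself: the square
    norm of the truncation equals the inner product of \<open>v\<close> with \<open>f\<close> of the
    truncation, and one factor cancels after Cauchy-Schwarz. The bound does not depend on
    \<open>V\<close>, so it yields both square summability of \<open>r v\<close> and boundedness of
    \<open>g\<close>.\<close>
  have partial_norm: "(\<Sum>x\<in>V. (hnorm (H x) (r v x))\<^sup>2) \<le> (c * hnorm D v)\<^sup>2"
    if v: "v \<in> hcar D" and V: "finite V" "V \<subseteq> X" for v V
  proof -
    let ?s = "zero_off V (r v)"
    have s: "?s \<in> hcar D" "(hnorm D ?s)\<^sup>2 = (\<Sum>x\<in>V. (hnorm (H x) (?s x))\<^sup>2)"
      by (rule finite_support_mem[OF V]; use V r[OF v] in \<open>auto simp: zero_off_def\<close>)+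
    have "complex_of_real ((hnorm D ?s)\<^sup>2) = (\<Sum>x\<in>V. hip (H x) (r v x) (r v x))"
      unfolding s(2) of_real_sum
      using V r[OF v] by (intro sum.cong) (auto simp: zero_off_def ip_space.ip_self[OF ip_space])
    also have "\<dots> = hip D v (f ?s)" using partial[OF v V] r[OF v] by simp
    finally have "(hnorm D ?s)\<^sup>2 = cmod (hip D v (f ?s))"
      by (metis norm_of_real abs_of_nonneg zero_le_power2)
    also have "\<dots> \<le> hnorm D v * hnorm D (f ?s)"
      using v s f by (intro cauchy_schwarz) (simp_all add: bop_mem)
    also have "\<dots> \<le> hnorm D v * (c * hnorm D ?s)"
      using c(2)[OF s(1)] hnorm_nonneg[OF v] by (rule mult_left_mono)
    finally have "hnorm D ?s * hnorm D ?s \<le> hnorm D ?s * (c * hnorm D v)"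
      by (simp add: power2_eq_square mult_ac)
    then have "hnorm D ?s \<le> c * hnorm D v"
      using hnorm_nonneg[OF s(1)] hnorm_nonneg[OF v] c(1)
      by (cases "hnorm D ?s = 0") (simp_all add: mult_le_cancel_left)
    then have "(hnorm D ?s)\<^sup>2 \<le> (c * hnorm D v)\<^sup>2"
      using hnorm_nonneg[OF s(1)] by (rule power_mono)
    then show ?thesis unfolding s(2) by (simp add: zero_off_def)
  qed
  have gD: "g v \<in> hcar D" and g_bound: "hnorm D (g v) \<le> c * hnorm D v" if v: "v \<in> hcar D" for v
  proof -
    have "(\<lambda>x. (hnorm (H x) (r v x))\<^sup>2) summable_on X"
      using partial_norm[OF v] by (intro nonneg_bdd_above_summable_on) (auto intro!: bdd_aboveI)
    then have sm: "(\<lambda>x. (hnorm (H x) (g v x))\<^sup>2) summable_on X"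
      using v by (simp add: g_def cong: summable_on_cong)
    then show gD: "g v \<in> hcar D" using v by (auto simp: mem_iff g_def r)
    have "(hnorm D (g v))\<^sup>2 \<le> (c * hnorm D v)\<^sup>2"
      unfolding hnorm_sq_eq[OF gD]
    proof (rule infsum_le_finite_sums[OF sm])
      fix V assume V: "finite V" "V \<subseteq> X"
      have "(\<Sum>x\<in>V. (hnorm (H x) (g v x))\<^sup>2) = (\<Sum>x\<in>V. (hnorm (H x) (r v x))\<^sup>2)"
        using V v by (intro sum.cong) (auto simp: g_def)
      then show "(\<Sum>x\<in>V. (hnorm (H x) (g v x))\<^sup>2) \<le> (c * hnorm D v)\<^sup>2"
        using partial_norm[OF v V] by simp
    qed
    then show "hnorm D (g v) \<le> c * hnorm D v"
      using c(1) hnorm_nonneg[OF v] by (intro power2_le_imp_le[of "hnorm D (g v)"]) simp_all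
  qed
  \<comment> \<open>The finite partial sums are the inner products of \<open>v\<close> with
    \<open>f (zero_off V u)\<close>. They converge to the claimed value because \<open>f\<close> is
    bounded and the projections of \<open>u\<close> tend to \<open>u\<close>.\<close>
  have g_ip': "hip D (g v) u = hip D v (f u)" if v: "v \<in> hcar D" and u: "u \<in> hcar D" for u v
  proof -
    have "((\<lambda>V. c * hnorm D v * hnorm D (u - zero_off V u)) \<longlongrightarrow> c * hnorm D v * 0) (finite_subsets_at_top X)"
      by (intro tendsto_intros zero_off_tendsto u)
    then have lim0: "((\<lambda>V. c * hnorm D v * hnorm D (u - zero_off V u)) \<longlongrightarrow> 0) (finite_subsets_at_top X)"
      by simp
    have "((\<lambda>V. (\<Sum>x\<in>V. hip (H x) (g v x) (u x)) - hip D v (f u)) \<longlongrightarrow> 0) (finite_subsets_at_top X)"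
    proof (rule Lim_null_comparison[OF _ lim0], rule eventually_finite_subsets_at_top_weakI)
      fix V assume V: "finite V" "V \<subseteq> X"
      have w: "u - zero_off V u \<in> hcar D" using u by (simp add: diff_mem zero_off_mem)
      have "(\<Sum>x\<in>V. hip (H x) (g v x) (u x)) = (\<Sum>x\<in>V. hip (H x) (r v x) (u x))"
        using V v by (intro sum.cong) (auto simp: g_def)
      also have "\<dots> = hip D v (f (zero_off V u))"
        using partial[OF v V] mem_component[OF u] by simp
      also have "f (zero_off V u) = f u - f (u - zero_off V u)"
        unfolding bop_diff[OF f u zero_off_mem(1)[OF u]] by simp
      also have "hip D v (f u - f (u - zero_off V u)) = hip D v (f u) - hip D v (f (u - zero_off V u))"
        by (rule ip_diff_right[OF v bop_mem[OF f u] bop_mem[OF f w]])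
      finally have "(\<Sum>x\<in>V. hip (H x) (g v x) (u x)) - hip D v (f u) = - hip D v (f (u - zero_off V u))"
        by simp
      then have "cmod ((\<Sum>x\<in>V. hip (H x) (g v x) (u x)) - hip D v (f u))
          \<le> hnorm D v * hnorm D (f (u - zero_off V u))"
        using cauchy_schwarz[OF v bop_mem[OF f w]] by simp
      also have "\<dots> \<le> hnorm D v * (c * hnorm D (u - zero_off V u))"
        using c(2)[OF w] hnorm_nonneg[OF v] by (rule mult_left_mono)
      finally show "cmod ((\<Sum>x\<in>V. hip (H x) (g v x) (u x)) - hip D v (f u))
          \<le> c * hnorm D v * hnorm D (u - zero_off V u)" by (simp add: mult_ac)
    qed
    then have "((\<lambda>x. hip (H x) (g v x) (u x)) has_sum hip D v (f u)) X"
      unfolding has_sum_def by (rule LIM_zero_cancel)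
    then show ?thesis unfolding hip_eq[of "g v"] by (rule infsumI)
  qed
  have g_ip: "hip D u (g v) = hip D (f u) v" if "u \<in> hcar D" "v \<in> hcar D" for u v
    using that herm[of "g v" u] herm[of v "f u"] by (simp add: gD g_ip' bop_mem[OF f])
  \<comment> \<open>The choices \<open>r v x\<close> are not made linearly in \<open>v\<close>.
    Linearity is recovered from \<open>g_ip\<close>, since a vector is determined by its inner
    products.\<close>
  have "g \<in> bop D"
  proof (rule bopI[OF gD _ _ _ g_bound])
    show "g (u + v) = g u + g v" if "u \<in> hcar D" "v \<in> hcar D" for u v
      using that by (intro eq_if_ip_eq) (simp_all add: gD add_mem g_ip ip_add_right bop_mem[OF f])
    show "g (a *\<^sub>C u) = a *\<^sub>C g u" if "u \<in> hcar D" for a u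
      using that by (intro eq_if_ip_eq) (simp_all add: gD scale_mem g_ip ip_scale_right bop_mem[OF f])
    show "g v = 0" if "v \<notin> hcar D" for v using that by (simp add: g_def fun_eq_iff)
  qed
  with g_ip show "\<exists>g\<in>bop D. \<forall>u\<in>hcar D. \<forall>v\<in>hcar D. hip D u (g v) = hip D (f u) v" by blast
qed

sublocale adj_space D
  by unfold_locales (rule adjointable_direct_sum)

subsection \<open>Finite-dimensional corners\<close>

text \<open>The part of \<open>\<A>\<close> living on the summands in \<open>V\<close>: with P the
  projection \<open>zero_off V\<close>, the conditions are P f = f and f P = f on the carrier. In
  this form the projection need not be shown to belong to \<open>\<A>\<close>.\<close>

definition corner :: "(('v \<Rightarrow> 'a) \<Rightarrow> 'v \<Rightarrow> 'a) set \<Rightarrow> 'v set \<Rightarrow> (('v \<Rightarrow> 'a) \<Rightarrow> 'v \<Rightarrow> 'a) set" where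
  "corner \<A> V = {f \<in> \<A>. \<forall>v\<in>hcar D. zero_off V (f v) = f v \<and> f (zero_off V v) = f v}"

lemma zero_off_add: "zero_off V (u + v :: 'v \<Rightarrow> 'a) = zero_off V u + zero_off V v"
  by (auto simp: zero_off_def fun_eq_iff)

lemma zero_off_diff: "zero_off V (u - v :: 'v \<Rightarrow> 'a) = zero_off V u - zero_off V v"
  by (auto simp: zero_off_def fun_eq_iff)

lemma zero_off_scale: "zero_off V (c *\<^sub>C u :: 'v \<Rightarrow> 'a) = c *\<^sub>C zero_off V u"
  by (auto simp: zero_off_def scaleC_fun_def fun_eq_iff)

lemma zero_off_zero [simp]: "zero_off V 0 = (0 :: 'v \<Rightarrow> 'a)"
  by (auto simp: zero_off_def fun_eq_iff)

text \<open>As the projection is self-adjoint, taking adjoints swaps the two defining equations.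
  They survive norm limits because the projection is a contraction.\<close>

lemma corner_cstar:
  assumes "cstar_subalgebra D \<A>"
  shows "cstar_subalgebra D (corner \<A> V)"
proof -
  let ?F = "corner \<A> V"
  have \<A>: "\<A> \<subseteq> bop D" "complex_vector.subspace \<A>" "\<And>f g. f \<in> \<A> \<Longrightarrow> g \<in> \<A> \<Longrightarrow> f \<circ> g \<in> \<A>"
    "\<And>f. f \<in> \<A> \<Longrightarrow> adj D D f \<in> \<A>" "op_closure D \<A> \<subseteq> \<A>"
    using assms by (auto simp: cstar_subalgebra_def)
  have mem: "f \<in> \<A>" "f \<in> bop D" "\<And>v. v \<in> hcar D \<Longrightarrow> zero_off V (f v) = f v"
    "\<And>v. v \<in> hcar D \<Longrightarrow> f (zero_off V v) = f v" if "f \<in> ?F" for f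
    using that \<A>(1) by (auto simp: corner_def)
  have "complex_vector.subspace ?F"
  proof (rule complex_vector.subspaceI)
    show "0 \<in> ?F" using complex_vector.subspace_0[OF \<A>(2)] by (simp add: corner_def)
    show "f + g \<in> ?F" if "f \<in> ?F" "g \<in> ?F" for f g
      using that complex_vector.subspace_add[OF \<A>(2)] by (simp add: corner_def zero_off_add)
    show "c *\<^sub>C f \<in> ?F" if "f \<in> ?F" for c f
      using that complex_vector.subspace_scale[OF \<A>(2)]
      by (simp add: corner_def zero_off_scale scaleC_fun_apply)
  qed
  moreover have "f \<circ> g \<in> ?F" if "f \<in> ?F" "g \<in> ?F" for f g
    using that \<A>(3) bop_mem[OF mem(2)[OF that(2)]] by (simp add: corner_def)
  moreover have "adj D D f \<in> ?F" if f: "f \<in> ?F" for f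
  proof -
    note fb = mem(2)[OF f]
    note ab = adj_mem[OF fb]
    have "zero_off V (adj D D f v) = adj D D f v" if v: "v \<in> hcar D" for v
    proof (rule eq_if_ip_eq[OF zero_off_mem(1)[OF bop_mem[OF ab v]] bop_mem[OF ab v]])
      fix u assume u: "u \<in> hcar D"
      have "hip D u (zero_off V (adj D D f v)) = hip D (zero_off V u) (adj D D f v)"
        by (rule zero_off_selfadjoint[OF u bop_mem[OF ab v]])
      also have "\<dots> = hip D (f (zero_off V u)) v" by (rule adj_ip[OF fb zero_off_mem(1)[OF u] v])
      also have "\<dots> = hip D u (adj D D f v)" by (simp only: mem(4)[OF f u] adj_ip[OF fb u v])
      finally show "hip D u (zero_off V (adj D D f v)) = hip D u (adj D D f v)" .
    qed
    moreover have "adj D D f (zero_off V v) = adj D D f v" if v: "v \<in> hcar D" for v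
    proof (rule eq_if_ip_eq[OF bop_mem[OF ab zero_off_mem(1)[OF v]] bop_mem[OF ab v]])
      fix u assume u: "u \<in> hcar D"
      have "hip D u (adj D D f (zero_off V v)) = hip D (f u) (zero_off V v)"
        by (rule adj_ip[OF fb u zero_off_mem(1)[OF v]])
      also have "\<dots> = hip D (zero_off V (f u)) v" by (rule zero_off_selfadjoint[OF bop_mem[OF fb u] v])
      also have "\<dots> = hip D u (adj D D f v)" by (simp only: mem(3)[OF f u] adj_ip[OF fb u v])
      finally show "hip D u (adj D D f (zero_off V v)) = hip D u (adj D D f v)" .
    qed
    ultimately show ?thesis using \<A>(4)[OF mem(1)[OF f]] by (simp add: corner_def)
  qed
  moreover have "op_closure D ?F \<subseteq> ?F"
  proof
    fix f assume f: "f \<in> op_closure D ?F"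
    have fb: "f \<in> bop D" using f by (simp add: op_closure_def)
    have "f \<in> op_closure D \<A>" using f by (fastforce simp: op_closure_def corner_def)
    then have fA: "f \<in> \<A>" using \<A>(5) by blast
    have approx: "\<exists>g\<in>?F. opnorm D (f - g) < e" if "e > 0" for e
      using f that by (simp add: op_closure_def)
    \<comment> \<open>The limit argument, stated once for both equations: a vector of norm at most
      \<open>2 * opnorm D (f - g) * hnorm D v\<close> for all \<open>g\<close> in the corner
      vanishes, because \<open>f\<close> is approximated by such \<open>g\<close>.\<close>
    have small: "x = 0" if v: "v \<in> hcar D" and x: "x \<in> hcar D"
      and le: "\<And>g. g \<in> ?F \<Longrightarrow> hnorm D x \<le> 2 * opnorm D (f - g) * hnorm D v" for x v
    proof (rule hnorm_eq_0D[OF x], rule antisym)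
      show "hnorm D x \<le> 0"
      proof (rule field_le_epsilon)
        fix e :: real assume e: "e > 0"
        \<comment> \<open>Chosen so that \<open>2 * d * (hnorm D v + 1) = e\<close>; the added 1
          avoids dividing by zero when \<open>v = 0\<close>.\<close>
        define d where "d = e / (2 * (hnorm D v + 1))"
        have nv: "0 \<le> hnorm D v" using v by (rule hnorm_nonneg)
        have d: "d > 0" using e nv by (simp add: d_def)
        obtain g where g: "g \<in> ?F" "opnorm D (f - g) < d" using approx[OF d] by blast
        have "hnorm D x \<le> 2 * opnorm D (f - g) * hnorm D v" by (rule le[OF g(1)])
        also have "\<dots> \<le> 2 * d * (hnorm D v + 1)"
          using g(2) nv d opnorm_nonneg[OF bop_minus[OF fb mem(2)[OF g(1)]]] by (intro mult_mono) simp_all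
        also have "\<dots> = e" using nv by (simp add: d_def field_simps add_nonneg_eq_0_iff)
        finally show "hnorm D x \<le> 0 + e" by simp
      qed
    qed (rule hnorm_nonneg[OF x])
    have "zero_off V (f v) = f v \<and> f (zero_off V v) = f v" if v: "v \<in> hcar D" for v
    proof
      have z: "zero_off V v \<in> hcar D" "zero_off V (f v) \<in> hcar D"
        using v fb by (simp_all add: zero_off_mem bop_mem)
      have bound: "hnorm D (a - b) \<le> 2 * opnorm D (f - g) * hnorm D v"
        if g: "g \<in> ?F" and a: "a \<in> hcar D" and b: "b \<in> hcar D"
          and "hnorm D a \<le> opnorm D (f - g) * hnorm D v" "hnorm D b \<le> opnorm D (f - g) * hnorm D v" for g a b
        using that hnorm_triangle[OF a scale_mem[OF b, of "-1"]] hnorm_scale[OF b, of "-1"] by simp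
      have "zero_off V (f v) - f v = 0"
      proof (rule small[OF v])
        fix g assume g: "g \<in> ?F"
        have d: "f - g \<in> bop D" using fb mem(2)[OF g] by (rule bop_minus)
        \<comment> \<open>The defect of \<open>g\<close> in the equation is zero, so the defect of
          \<open>f\<close> is that of \<open>f - g\<close>. It is a difference of two terms of norm
          at most \<open>opnorm D (f - g) * hnorm D v\<close>, whence the factor 2.\<close>
        have eq: "zero_off V (f v) - f v = zero_off V ((f - g) v) - (f - g) v"
          using mem(3)[OF g v] by (simp add: zero_off_diff)
        show "hnorm D (zero_off V (f v) - f v) \<le> 2 * opnorm D (f - g) * hnorm D v"
          unfolding eq
          by (rule bound[OF g zero_off_mem(1)[OF bop_mem[OF d v]] bop_mem[OF d v]
                order_trans[OF hnorm_zero_off_le[OF bop_mem[OF d v]] opnorm_bound[OF d v]] opnorm_bound[OF d v]])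
      qed (use z v fb in \<open>simp add: diff_mem bop_mem\<close>)
      then show "zero_off V (f v) = f v" by simp
      have "f (zero_off V v) - f v = 0"
      proof (rule small[OF v])
        fix g assume g: "g \<in> ?F"
        have d: "f - g \<in> bop D" using fb mem(2)[OF g] by (rule bop_minus)
        have eq: "f (zero_off V v) - f v = (f - g) (zero_off V v) - (f - g) v"
          using mem(4)[OF g v] by simp
        have le: "hnorm D ((f - g) (zero_off V v)) \<le> opnorm D (f - g) * hnorm D v"
          using opnorm_bound[OF d z(1)] mult_left_mono[OF hnorm_zero_off_le[OF v, of V] opnorm_nonneg[OF d]]
          by linarith
        show "hnorm D (f (zero_off V v) - f v) \<le> 2 * opnorm D (f - g) * hnorm D v"
          unfolding eq by (rule bound[OF g bop_mem[OF d z(1)] bop_mem[OF d v] le opnorm_bound[OF d v]])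
      qed (use z v fb in \<open>simp add: diff_mem bop_mem\<close>)
      then show "f (zero_off V v) = f v" by simp
    qed
    then show "f \<in> ?F" using fA by (simp add: corner_def)
  qed
  ultimately show ?thesis using \<A>(1) by (auto simp: cstar_subalgebra_def corner_def)
qed

text \<open>An operator in the corner is determined by its finite matrix in the orthonormal bases of
  the summands in \<open>V\<close>, so it is a combination of the matrix units
  \<open>E x b y b'\<close>. These only have to span; they are not claimed to lie in
  \<open>\<A>\<close>.\<close>

lemma corner_finite_dim:
  assumes \<A>: "\<A> \<subseteq> bop D" and V: "finite V" "V \<subseteq> X"
  shows "finite_dim (corner \<A> V)"
proof -
  have "\<exists>B. finite B \<and> B \<subseteq> hcar (H x) \<and> (\<forall>a\<in>hcar (H x). a = (\<Sum>b\<in>B. hip (H x) b a *\<^sub>C b))"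
    if "x \<in> X" for x
    by (rule ip_space.finite_onb[OF ip_space[OF that] finite_dim[OF that]]) blast
  then obtain B where B: "\<And>x. x \<in> X \<Longrightarrow> finite (B x)" "\<And>x. x \<in> X \<Longrightarrow> B x \<subseteq> hcar (H x)"
    "\<And>x a. x \<in> X \<Longrightarrow> a \<in> hcar (H x) \<Longrightarrow> a = (\<Sum>b\<in>B x. hip (H x) b a *\<^sub>C b)"
    by metis
  \<comment> \<open>The rank-one operator taking the basis vector \<open>b\<close> at
    \<open>x\<close> to the basis vector \<open>b'\<close> at \<open>y\<close>. It is cut off
    outside the carrier so that the expansion of \<open>f\<close> is an equality of
    functions.\<close>
  define E where "E x b y b' = (\<lambda>v. if v \<in> hcar D then hip (H x) b (v x) *\<^sub>C single y b' else 0)" for x y :: 'v and b b' :: 'a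
  define U where "U = (\<lambda>((x, b), (y, b')). E x b y b') ` ((SIGMA x:V. B x) \<times> (SIGMA x:V. B x))"
  have "finite (SIGMA x:V. B x)" using V B(1) by (intro finite_SigmaI) auto
  then have finU: "finite U" unfolding U_def by (intro finite_imageI finite_cartesian_product)
  have EU: "E x b y b' \<in> U" if "x \<in> V" "b \<in> B x" "y \<in> V" "b' \<in> B y" for x b y b'
    unfolding U_def using that by (intro image_eqI[of _ _ "((x, b), (y, b'))"]) auto
  have single0: "single x (\<Sum>b\<in>C. c b *\<^sub>C b) = (\<Sum>b\<in>C. c b *\<^sub>C single x b)" for x :: 'v and C :: "'a set" and c
    by (auto simp: single_def fun_eq_iff sum_fun scaleC_fun_def)
  have "f \<in> complex_vector.span U" if f: "f \<in> corner \<A> V" for f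
  proof -
    have fb: "f \<in> bop D" and f1: "\<And>v. v \<in> hcar D \<Longrightarrow> zero_off V (f v) = f v"
      and f2: "\<And>v. v \<in> hcar D \<Longrightarrow> f (zero_off V v) = f v"
      using f \<A> by (auto simp: corner_def)
    have expand: "zero_off V v = (\<Sum>x\<in>V. \<Sum>b\<in>B x. hip (H x) b (v x) *\<^sub>C single x b)" if v: "v \<in> hcar D" for v
      unfolding zero_off_eq_sum_single[OF V(1)]
    proof (rule sum.cong[OF refl])
      fix x assume "x \<in> V"
      then have x: "x \<in> X" using V by blast
      show "single x (v x) = (\<Sum>b\<in>B x. hip (H x) b (v x) *\<^sub>C single x b)"
        using arg_cong[OF B(3)[OF x mem_component[OF v x]], of "single x"] by (simp only: single0)
    qed
    have sB: "single x b \<in> hcar D" if "x \<in> V" "b \<in> B x" for x b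
      using that V B(2) by (intro single_mem) auto
    \<comment> \<open>Expanding the images of basis vectors gives the matrix entries of
      \<open>f\<close>; only coordinates in \<open>V\<close> occur because the projection fixes the
      range of \<open>f\<close>.\<close>
    have fe: "f (single x b) = (\<Sum>y\<in>V. \<Sum>b'\<in>B y. hip (H y) b' (f (single x b) y) *\<^sub>C single y b')"
      if "x \<in> V" "b \<in> B x" for x b
      by (rule trans[OF f1[OF sB[OF that], symmetric] expand[OF bop_mem[OF fb sB[OF that]]]])
    let ?g = "\<Sum>x\<in>V. \<Sum>b\<in>B x. \<Sum>y\<in>V. \<Sum>b'\<in>B y. hip (H y) b' (f (single x b) y) *\<^sub>C E x b y b'"
    have "f v = ?g v" for v
    proof (cases "v \<in> hcar D")
      case v: True
      have E: "E x b y b' v = hip (H x) b (v x) *\<^sub>C single y b'" for x y b b' using v by (simp add: E_def)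
      have "f v = f (\<Sum>x\<in>V. \<Sum>b\<in>B x. hip (H x) b (v x) *\<^sub>C single x b)"
        using f2[OF v] expand[OF v] by simp
      also have "\<dots> = (\<Sum>x\<in>V. \<Sum>b\<in>B x. hip (H x) b (v x) *\<^sub>C f (single x b))"
        using fb sB by (simp add: bop_sum sum_mem scale_mem bop_scale)
      also have "\<dots> = (\<Sum>x\<in>V. \<Sum>b\<in>B x. hip (H x) b (v x) *\<^sub>C
          (\<Sum>y\<in>V. \<Sum>b'\<in>B y. hip (H y) b' (f (single x b) y) *\<^sub>C single y b'))"
        by (intro sum.cong refl arg_cong[where f = "scaleC _"] fe)
      also have "\<dots> = ?g v"
        by (simp only: sum_fun scaleC_fun_apply E complex_vector.scale_sum_right scaleC_scaleC mult.commute)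
      finally show ?thesis .
    next
      case False
      then have "E x b y b' v = 0" for x y b b' by (simp add: E_def)
      then show ?thesis
        using False by (simp only: bop_off[OF fb False] sum_fun scaleC_fun_apply complex_vector.scale_zero_right
          sum.neutral_const)
    qed
    then have "f = ?g" by (rule ext)
    also have "?g \<in> complex_vector.span U"
      using EU by (intro complex_vector.span_sum complex_vector.span_scale complex_vector.span_base)
    finally show ?thesis .
  qed
  then show ?thesis using finU unfolding finite_dim_def by blast
qed

section \<open>Generators: boundedness and position in the corners\<close>

lemma edge_op_mem:
  assumes x: "x \<in> X" and y: "y \<in> X" and a: "a \<in> bops (H x) (H y)"
  shows "edge_op X H x y a \<in> bop D"
proof -
  obtain C where C: "\<And>u. u \<in> hcar (H x) \<Longrightarrow> hnorm (H y) (a u) \<le> C * hnorm (H x) u"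
    using a by (auto simp: bops_def)
  have amem: "a u \<in> hcar (H y)" if "u \<in> hcar (H x)" for u using a that by (auto simp: bops_def)
  have aadd: "a (u + v) = a u + a v" if "u \<in> hcar (H x)" "v \<in> hcar (H x)" for u v
    using a that by (auto simp: bops_def clinear_on_def)
  have ascale: "a (c *\<^sub>C u) = c *\<^sub>C a u" if "u \<in> hcar (H x)" for c u
    using a that by (auto simp: bops_def clinear_on_def)
  have eq: "edge_op X H x y a v = single y (a (v x))" if "v \<in> hcar D" for v
    using that by (simp add: edge_op_def single_def)
  show ?thesis
  \<comment> \<open>If \<open>H x\<close> is the zero space, \<open>C\<close> may be negative while
    \<open>v\<close> has positive norm, so \<open>C\<close> itself would not do.\<close>
  proof (rule bopI[where C = "\<bar>C\<bar>"])
    fix v assume v: "v \<in> hcar D"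
    then have vx: "v x \<in> hcar (H x)" using x by (rule mem_component)
    show "edge_op X H x y a v \<in> hcar D" using v y amem[OF vx] by (simp add: eq single_mem)
    have "hnorm D (edge_op X H x y a v) = hnorm (H y) (a (v x))"
      using v y amem[OF vx] by (simp add: eq single_mem)
    also have "\<dots> \<le> C * hnorm (H x) (v x)" by (rule C[OF vx])
    also have "\<dots> \<le> \<bar>C\<bar> * hnorm D v"
      using hnorm_component_le[OF v x] ip_space.hnorm_nonneg[OF ip_space[OF x] vx] by (intro mult_mono) simp_all
    finally show "hnorm D (edge_op X H x y a v) \<le> \<bar>C\<bar> * hnorm D v" .
  next
    fix u v assume u: "u \<in> hcar D" and v: "v \<in> hcar D"
    show "edge_op X H x y a (u + v) = edge_op X H x y a u + edge_op X H x y a v"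
      using u v x by (simp add: eq add_mem mem_component aadd single_add)
  next
    fix c u assume u: "u \<in> hcar D"
    show "edge_op X H x y a (c *\<^sub>C u) = c *\<^sub>C edge_op X H x y a u"
      using u x scale_mem[OF u, of c] by (simp add: eq mem_component scaleC_fun_apply ascale single_scale)
  qed (simp add: edge_op_def)
qed

text \<open>Such an operator reads only the coordinate at \<open>x\<close> and writes only the
  coordinate at \<open>y\<close>.\<close>

lemma edge_op_corner:
  assumes "edge_op X H x y a \<in> \<A>" "x \<in> V" "y \<in> V"
  shows "edge_op X H x y a \<in> corner \<A> V"
  using assms by (auto simp: corner_def edge_op_def zero_off_mem) (auto simp: zero_off_def fun_eq_iff)

text \<open>Lets vertex projections be treated as loops, so that both kinds of generators have one
  form.\<close>

lemma proj_op_eq_edge_op: "proj_op X H x = edge_op X H x x (\<lambda>a. a)"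
  by (simp add: proj_op_def edge_op_def)

lemma proj_op_mem:
  assumes x: "x \<in> X"
  shows "proj_op X H x \<in> bop D"
proof -
  interpret Hx: ip_space "H x" by (rule ip_space[OF x])
  \<comment> \<open>The plain identity need not vanish off the carrier and so need not lie in
    \<open>bop (H x)\<close>. The cut-off version gives the same edge operator, since components of
    vectors of \<open>D\<close> lie in the carriers.\<close>
  have "(\<lambda>a. if a \<in> hcar (H x) then a else 0) \<in> bop (H x)"
    by (rule Hx.bopI[where C = 1]) (auto simp: Hx.add_mem Hx.scale_mem)
  then have "edge_op X H x x (\<lambda>a. if a \<in> hcar (H x) then a else 0) \<in> bop D"
    by (rule edge_op_mem[OF x x])
  also have "edge_op X H x x (\<lambda>a. if a \<in> hcar (H x) then a else 0) = proj_op X H x"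
    using x by (auto simp: proj_op_def edge_op_def fun_eq_iff mem_component)
  finally show ?thesis .
qed

lemma AF_generated:
  assumes X: "countable X"
    and edges: "\<And>a. a \<in> Q \<Longrightarrow> \<exists>x\<in>X. \<exists>y\<in>X. \<exists>h. a = edge_op X H x y h"
    and Q: "Q \<subseteq> bop D"
  shows "AF_algebra D (cstar_generated D Q)"
proof -
  let ?A = "cstar_generated D Q"
  have A: "cstar_subalgebra D ?A" using Q by (rule cstar_generated_cstar)
  have QA: "Q \<subseteq> ?A" by (auto simp: cstar_generated_def)
  have Ab: "?A \<subseteq> bop D" using A by (simp add: cstar_subalgebra_def)
  \<comment> \<open>Finite initial segments of an enumeration of \<open>X\<close>; for finite
    \<open>X\<close> they are eventually all of \<open>X\<close>, so no case distinction
    arises.\<close>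
  define V where "V n = {x \<in> X. to_nat_on X x < n}" for n
  have "inj_on (to_nat_on X) (V n)" for n
    using inj_on_to_nat_on[OF X] by (rule inj_on_subset) (auto simp: V_def)
  then have Vfin: "finite (V n)" for n
    by (rule inj_on_finite[where B = "{..<n}"]) (auto simp: V_def)
  have VX: "V n \<subseteq> X" for n by (auto simp: V_def)
  define F where "F n = corner ?A (V n)" for n
  have F: "cstar_subalgebra D (F n)" "finite_dim (F n)" for n
    unfolding F_def using A Ab Vfin VX by (simp_all add: corner_cstar corner_finite_dim)
  have Fmono: "F m \<subseteq> F n" if "m \<le> n" for m n
  proof
    fix f assume f: "f \<in> F m"
    have fb: "f \<in> bop D" using f Ab by (auto simp: F_def corner_def)
    have VV: "V m \<subseteq> V n" using that by (auto simp: V_def)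
    have "zero_off (V n) (f v) = f v \<and> f (zero_off (V n) v) = f v" if v: "v \<in> hcar D" for v
    proof
      \<comment> \<open>For nested sets the smaller projection absorbs the larger one on either
        side.\<close>
      have *: "zero_off (V n) (zero_off (V m) u) = zero_off (V m) u"
        "zero_off (V m) (zero_off (V n) u) = zero_off (V m) u" for u :: "'v \<Rightarrow> 'a"
        using VV by (auto simp: zero_off_def fun_eq_iff)
      have f': "zero_off (V m) (f u) = f u" "f (zero_off (V m) u) = f u" if "u \<in> hcar D" for u
        using f that by (auto simp: F_def corner_def)
      show "zero_off (V n) (f v) = f v" using * f'(1)[OF v] by metis
      have "f (zero_off (V n) v) = f (zero_off (V m) (zero_off (V n) v))"
        by (rule f'(2)[symmetric]) (simp add: zero_off_mem v)
      also have "\<dots> = f v" using * f'(2)[OF v] by simp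
      finally show "f (zero_off (V n) v) = f v" .
    qed
    then show "f \<in> F n" using f by (simp add: F_def corner_def)
  qed
  let ?U = "\<Union>n. F n"
  \<comment> \<open>Along an increasing chain two elements share a member, which makes the union
    closed under sums and products.\<close>
  have two: "\<exists>n. f \<in> F n \<and> g \<in> F n" if "f \<in> ?U" "g \<in> ?U" for f g
  proof -
    obtain m n where "f \<in> F m" "g \<in> F n" using \<open>f \<in> ?U\<close> \<open>g \<in> ?U\<close> by blast
    then show ?thesis using Fmono[of m "max m n"] Fmono[of n "max m n"] by auto
  qed
  have Fss: "complex_vector.subspace (F n)" for n using F(1) by (simp add: cstar_subalgebra_def)
  have UA: "?U \<subseteq> ?A" by (auto simp: F_def corner_def)
  have "complex_vector.subspace ?U"
  proof (rule complex_vector.subspaceI)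
    show "0 \<in> ?U" using complex_vector.subspace_0[OF Fss] by blast
    show "f + g \<in> ?U" if "f \<in> ?U" "g \<in> ?U" for f g
      using two[OF that] complex_vector.subspace_add[OF Fss] by blast
    show "c *\<^sub>C f \<in> ?U" if "f \<in> ?U" for c f
      using that complex_vector.subspace_scale[OF Fss] by blast
  qed
  moreover have "f \<circ> g \<in> ?U" if "f \<in> ?U" "g \<in> ?U" for f g
    using two[OF that] F(1) unfolding cstar_subalgebra_def by blast
  moreover have "adj D D f \<in> ?U" if "f \<in> ?U" for f
    using that F(1) unfolding cstar_subalgebra_def by blast
  ultimately have C: "cstar_subalgebra D (op_closure D ?U)"
    using UA Ab by (intro cstar_op_closure) auto
  have "Q \<subseteq> ?U"
  proof
    fix a assume a: "a \<in> Q"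
    then obtain x y h where e: "x \<in> X" "y \<in> X" "a = edge_op X H x y h" using edges by blast
    \<comment> \<open>Membership in \<open>V n\<close> is a strict inequality, hence the successor
      of the larger index.\<close>
    define n where "n = Suc (max (to_nat_on X x) (to_nat_on X y))"
    have "x \<in> V n" "y \<in> V n" using e by (auto simp: V_def n_def)
    then have "a \<in> F n" using a QA e unfolding F_def by (auto intro: edge_op_corner)
    then show "a \<in> ?U" by blast
  qed
  moreover have "?U \<subseteq> op_closure D ?U"
    using UA Ab by (intro subset_op_closure) auto
  \<comment> \<open>The closure is one of the C*-subalgebras containing the generators, so it takes
    part in the intersection that defines \<open>?A\<close>.\<close>
  ultimately have "?A \<subseteq> op_closure D ?U"
    using C unfolding cstar_generated_def by blast
  moreover have "op_closure D ?U \<subseteq> ?A"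
  proof -
    have "op_closure D ?U \<subseteq> op_closure D ?A" using UA by (rule op_closure_mono)
    then show ?thesis using A by (auto simp: cstar_subalgebra_def)
  qed
  ultimately have "?A = op_closure D ?U" by blast
  then show ?thesis
    unfolding AF_algebra_def using A F Fmono[OF le_SucI[OF order_refl]] by blast
qed

end

theorem theorem4p3:
  fixes G :: "('v,'e) pre_digraph"
    and H :: "'v \<Rightarrow> 'a::complex_vector hspace"
    and \<Phi> :: "'v \<Rightarrow> 'v \<Rightarrow> ('a \<Rightarrow> 'a) \<Rightarrow> 'a \<Rightarrow> 'a"
    and \<Psi> :: "'e \<Rightarrow> ('a \<Rightarrow> 'a) \<Rightarrow> 'a \<Rightarrow> 'a"
    and I :: "'e \<Rightarrow> 'i set"
    and A :: "'e \<Rightarrow> 'i \<Rightarrow> 'a \<Rightarrow> 'a"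
  assumes "quantum_causal_history G H \<Phi>"
    and "\<forall>e\<in>arcs G. \<Psi> e = \<Phi> (tail G e) (head G e)"
    and "\<forall>e\<in>arcs G. operator_sum (H (tail G e)) (H (head G e)) (\<Psi> e) (I e) (A e)"
  shows "AF_algebra (direct_sum (verts G) H) (graph_algebra G H I A)"
proof -
  have G: "nomulti_digraph G" "countable (verts G)"
    and hilb: "\<forall>x\<in>verts G. hilbert_space (H x) \<and> finite_dim (hcar (H x))"
    using assms(1) unfolding quantum_causal_history_def by blast+
  interpret nomulti_digraph G by (rule G)
  interpret hilbert_family "verts G" H
    using hilb by (auto intro!: hilbert_family.intro hilbert_space_ip_space)
  \<comment> \<open>The operator-sum representations enter by making each of their operators bounded
    between the spaces at the ends of its edge.\<close>
  have A: "A e i \<in> bops (H (tail G e)) (H (head G e))" if "e \<in> arcs G" "i \<in> I e" for e i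
    using assms(3) that by (simp add: operator_sum_def)
  show ?thesis
    unfolding graph_algebra_def
  proof (rule AF_generated[OF G(2)])
    fix a assume "a \<in> {proj_op (verts G) H x |x. x \<in> verts G} \<union>
      {edge_op (verts G) H (tail G e) (head G e) (A e i) |e i. e \<in> arcs G \<and> i \<in> I e}"
    then show "\<exists>x\<in>verts G. \<exists>y\<in>verts G. \<exists>h. a = edge_op (verts G) H x y h"
      using proj_op_eq_edge_op tail_in_verts head_in_verts by blast
  next
    show "{proj_op (verts G) H x |x. x \<in> verts G} \<union>
      {edge_op (verts G) H (tail G e) (head G e) (A e i) |e i. e \<in> arcs G \<and> i \<in> I e} \<subseteq> bop D"
      using proj_op_mem edge_op_mem A by auto
  qed
qed

end
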